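(* Let $G$ be the path on vertices $1,\dots,n$, let $q=3$, and let $\Omega$ be the set of proper $3$-colorings of $G$. Let $\mathcal{M}_{\mathrm{Gl}}$ be the Glauber dynamics on $\Omega$. Then, as $n\to\infty$, $$\mathrm{Mix}\left(\mathcal{M}_{\mathrm{Gl}},\tfrac14\right)=O(n^3\log n).$$
   Context: The $n$-vertex path has vertices $1,\dots,n$ and edges $\{i,i+1\}$. A $q$-coloring is a vector $\sigma=(\sigma_1,\dots,\sigma_n)\in\{0,\dots,q-1\}^n$; it is proper if adjacent vertices receive different colors. The procedure Metropolis($v$): choose a color $c\in\{0,\dots,q-1\}$ uniformly at random and propose recoloring $v$ with $c$; the proposal is accepted if and only if $c$ is not used at any neighbor of $v$ (otherwise the coloring is unchanged). One step of the Markov chain $\mathcal{M}_{\mathrm{Gl}}$ (Glauber dynamics): choose a vertex $v$ uniformly at random and do Metropolis($v$). Its stationary distribution is uniform on $\Omega$. For a Markov chain $\mathcal{M}$ with transition matrix $P$ and stationary distribution $\pi$, $\mathrm{Mix}_x(\mathcal{M},\varepsilon)=\min\{t>0:\mathrm{d_{TV}}(P^t(x,\cdot),\pi(\cdot))\le\varepsilon\}$ and $\mathrm{Mix}(\mathcal{M},\varepsilon)=\max_x\mathrm{Mix}_x(\mathcal{M},\varepsilon)$, where $\mathrm{d_{TV}}(\theta_1,\theta_2)=\frac12\sum_i|\theta_1(i)-\theta_2(i)|$. *)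

theory Defs
  imports "HOL-Probability.Probability_Mass_Function" "HOL-Library.Landau_Symbols"
    "HOL-Library.Extended_Nat"
begin

definition path_adj :: "nat \<Rightarrow> nat \<Rightarrow> nat \<Rightarrow> bool" where
  "path_adj n u v \<longleftrightarrow> u \<in> {1..n} \<and> v \<in> {1..n} \<and> (v = Suc u \<or> u = Suc v)"

text \<open>A coloring is a function that is extensional on \<open>{1..n}\<close>, so that there are exactly
  \<open>q ^ n\<close> of them.\<close>

definition proper_colorings :: "nat \<Rightarrow> nat \<Rightarrow> (nat \<Rightarrow> nat) set" where
  "proper_colorings q n =
     {\<sigma> \<in> {1..n} \<rightarrow>\<^sub>E {0..<q}. \<forall>u v. path_adj n u v \<longrightarrow> \<sigma> u \<noteq> \<sigma> v}"

definition metropolis :: "nat \<Rightarrow> nat \<Rightarrow> nat \<Rightarrow> (nat \<Rightarrow> nat) \<Rightarrow> (nat \<Rightarrow> nat) pmf" where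
  "metropolis q n v \<sigma> =
     map_pmf (\<lambda>c. if \<forall>w. path_adj n v w \<longrightarrow> \<sigma> w \<noteq> c then \<sigma>(v := c) else \<sigma>)
       (pmf_of_set {0..<q})"

text \<open>Meaningful for \<open>n \<ge> 1\<close> and \<open>q \<ge> 1\<close> only, since \<open>pmf_of_set {}\<close> is unspecified.\<close>

definition glauber :: "nat \<Rightarrow> nat \<Rightarrow> (nat \<Rightarrow> nat) \<Rightarrow> (nat \<Rightarrow> nat) pmf" where
  "glauber q n \<sigma> = bind_pmf (pmf_of_set {1..n}) (\<lambda>v. metropolis q n v \<sigma>)"

text \<open>A Markov chain on a finite state space \<open>S\<close> is given by a kernel \<open>K\<close>, where \<open>K x\<close> is the row
  of \<open>x\<close> in the transition matrix; \<open>chain_dist K t x\<close> is the row of \<open>x\<close> in its \<open>t\<close>-th power.\<close>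

definition chain_dist :: "('s \<Rightarrow> 's pmf) \<Rightarrow> nat \<Rightarrow> 's \<Rightarrow> 's pmf" where
  "chain_dist K t x = ((\<lambda>\<mu>. bind_pmf \<mu> K) ^^ t) (return_pmf x)"

definition tv_dist :: "'s set \<Rightarrow> 's pmf \<Rightarrow> 's pmf \<Rightarrow> real" where
  "tv_dist S \<mu> \<nu> = 1 / 2 * (\<Sum>i\<in>S. \<bar>pmf \<mu> i - pmf \<nu> i\<bar>)"

text \<open>Mixing times take values in \<^typ>\<open>enat\<close>, so that the value is \<open>\<infinity>\<close>, and not an unspecified number,
  if the threshold is never reached. An infimum of a nonempty set of extended naturals is
  its minimum, and the supremum below is a maximum if \<open>S\<close> is finite and nonempty.\<close>

definition mix_from :: "'s set \<Rightarrow> ('s \<Rightarrow> 's pmf) \<Rightarrow> 's pmf \<Rightarrow> real \<Rightarrow> 's \<Rightarrow> enat" where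
  "mix_from S K \<pi> \<epsilon> x = (INF t \<in> {t. t > 0 \<and> tv_dist S (chain_dist K t x) \<pi> \<le> \<epsilon>}. enat t)"

definition mix :: "'s set \<Rightarrow> ('s \<Rightarrow> 's pmf) \<Rightarrow> 's pmf \<Rightarrow> real \<Rightarrow> enat" where
  "mix S K \<pi> \<epsilon> = (SUP x \<in> S. mix_from S K \<pi> \<epsilon> x)"

definition glauber_mix :: "nat \<Rightarrow> nat \<Rightarrow> real \<Rightarrow> enat" where
  "glauber_mix q n \<epsilon> =
     mix (proper_colorings q n) (glauber q n) (pmf_of_set (proper_colorings q n)) \<epsilon>"

text \<open>The chain stays in the set of proper colorings, and the uniform distribution on this set
  is stationary.\<close>

lemma finite_proper_colorings: "finite (proper_colorings q n)"
  by (rule finite_subset[OF _ finite_PiE[of "{1..n}" "\<lambda>_. {0..<q}"]])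
     (auto simp: proper_colorings_def)

lemma proper_colorings_nonempty:
  assumes "q \<ge> 2" shows "proper_colorings q n \<noteq> {}"
proof -
  have "restrict (\<lambda>i. i mod 2) {1..n} \<in> proper_colorings q n"
    using assms by (auto simp: proper_colorings_def path_adj_def mod_Suc split: if_splits)
  then show ?thesis by blast
qed

lemma set_pmf_metropolis:
  assumes "q \<ge> 1" "v \<in> {1..n}" "\<sigma> \<in> proper_colorings q n"
  shows "set_pmf (metropolis q n v \<sigma>) \<subseteq> proper_colorings q n"
proof -
  have "(if \<forall>w. path_adj n v w \<longrightarrow> \<sigma> w \<noteq> c then \<sigma>(v := c) else \<sigma>) \<in> proper_colorings q n"
    if "c < q" for c
    using assms(2,3) that
    by (auto simp: proper_colorings_def PiE_iff extensional_def path_adj_def)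
  then have "(\<lambda>c. if \<forall>w. path_adj n v w \<longrightarrow> \<sigma> w \<noteq> c then \<sigma>(v := c) else \<sigma>) ` {0..<q}
      \<subseteq> proper_colorings q n"
    by (intro image_subsetI) simp
  then show ?thesis
    using assms(1) unfolding metropolis_def set_map_pmf by (subst set_pmf_of_set) simp_all
qed

lemma set_pmf_glauber:
  assumes "q \<ge> 1" "n \<ge> 1" "\<sigma> \<in> proper_colorings q n"
  shows "set_pmf (glauber q n \<sigma>) \<subseteq> proper_colorings q n"
proof -
  have "set_pmf (pmf_of_set {1..n}) = {1..n}"
    using assms(2) by (intro set_pmf_of_set) auto
  then show ?thesis
    using set_pmf_metropolis[OF assms(1) _ assms(3)]
    unfolding glauber_def set_bind_pmf by (intro UN_least) simp
qed

lemma metropolis_sym: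
  assumes q: "q \<ge> 1" and v: "v \<in> {1..n}"
    and x: "x \<in> proper_colorings q n" and y: "y \<in> proper_colorings q n"
  shows "pmf (metropolis q n v x) y = pmf (metropolis q n v y) x"
proof (cases "x = y")
  case False
  have step: "{0..<q} \<inter> (\<lambda>c. if \<forall>w. path_adj n v w \<longrightarrow> a w \<noteq> c then a(v := c) else a) -` {b} =
      (if \<forall>w. w \<noteq> v \<longrightarrow> a w = b w then {b v} else {})" (is "?L = ?R")
    if ab: "a \<in> proper_colorings q n" "b \<in> proper_colorings q n" "a \<noteq> b" for a b
  proof (cases "\<forall>w. w \<noteq> v \<longrightarrow> a w = b w")
    case True
    have 1: "b v < q" using ab(2) v by (auto simp: proper_colorings_def)
    have 2: "\<forall>w. path_adj n v w \<longrightarrow> a w \<noteq> b v"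
    proof (intro allI impI)
      fix w assume w: "path_adj n v w"
      then have "w \<noteq> v" "b v \<noteq> b w"
        using ab(2) by (auto simp: path_adj_def proper_colorings_def)
      then show "a w \<noteq> b v" using True by auto
    qed
    have 3: "a(v := b v) = b" using True by (auto simp: fun_eq_iff)
    show ?thesis using True 1 2 3 ab(3) by (auto split: if_splits)
  next
    case False
    then show ?thesis using ab(3) by (auto split: if_splits)
  qed
  have ne: "{0..<q} \<noteq> {}" using q by auto
  show ?thesis
    using step[OF x y False] step[OF y x False[symmetric]]
    by (cases "\<forall>w. w \<noteq> v \<longrightarrow> x w = y w")
       (simp_all add: metropolis_def pmf_map measure_pmf_of_set[OF ne] eq_commute[of "y _" "x _"])
qed simp

lemma glauber_sym:
  assumes "q \<ge> 1" "n \<ge> 1" "x \<in> proper_colorings q n" "y \<in> proper_colorings q n"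
  shows "pmf (glauber q n x) y = pmf (glauber q n y) x"
  using assms by (simp add: glauber_def pmf_bind_pmf_of_set metropolis_sym)

lemma uniform_stationary:
  assumes "q \<ge> 2" "n \<ge> 1"
  shows "bind_pmf (pmf_of_set (proper_colorings q n)) (glauber q n) =
    pmf_of_set (proper_colorings q n)"
proof (rule pmf_eqI)
  fix y
  let ?S = "proper_colorings q n"
  note S = proper_colorings_nonempty[OF assms(1), of n] finite_proper_colorings[of q n]
  have q: "q \<ge> 1" using assms(1) by simp
  have "(\<Sum>x\<in>?S. pmf (glauber q n x) y) = indicator ?S y"
  proof (cases "y \<in> ?S")
    case True
    then have "(\<Sum>x\<in>?S. pmf (glauber q n x) y) = (\<Sum>x\<in>?S. pmf (glauber q n y) x)"
      using glauber_sym[OF q assms(2)] by (intro sum.cong) auto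
    also have "\<dots> = 1"
      using S(2) set_pmf_glauber[OF q assms(2) True] by (rule sum_pmf_eq_1)
    finally show ?thesis using True by simp
  next
    case False
    then have "pmf (glauber q n x) y = 0" if "x \<in> ?S" for x
      using set_pmf_glauber[OF q assms(2) that] by (auto simp: set_pmf_iff)
    then show ?thesis using False by simp
  qed
  then show "pmf (bind_pmf (pmf_of_set ?S) (glauber q n)) y = pmf (pmf_of_set ?S) y"
    using S by (simp add: pmf_bind_pmf_of_set)
qed

end

theory Submission
  imports Defs
begin

text \<open>
  A proper 3-coloring of the path is, up to a multiple of 3, the same as a height function: an
  integer function whose consecutive values differ by 1. At a vertex whose neighbours are at the same
  height, Metropolis reflects the vertex at that height with probability 1/3; at an end of the path
  the only neighbour counts twice; in all other cases nothing moves. In every case the expected new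
  height is an affine combination of the old heights, so that expected heights follow a discrete heat
  equation with reflecting ends. The theorem follows from two couplings of two copies, which are run one
  after the other, each for order \<open>n ^ 3 * ln n\<close> steps. Both have a potential that contracts by
  a factor \<open>1 - c / n ^ 3\<close> per step in expectation, is bounded by a polynomial in \<open>n\<close>, and is
  at least 1 as long as the phase has not succeeded (\<open>prob_le_contracting_potential\<close>).

  The first phase makes the slopes of the two copies equal. A flip inside the path exchanges two adjacent
  slopes and a flip at an end reverses the last one. If inside the path both copies always flip
  together, then the positions where the slopes differ move like random walks that exclude each other and
  are absorbed at the ends. The weight \<open>i * (n - i)\<close> of a position has constant second difference,
  and the total weight of the mismatches contracts (\<open>mismatch_potential_contracts\<close>).

  After that the heights differ by a constant, and the colorings by a rotation of the colors. This
  constant may be taken from 0, 2, 4, so that the second copy lies between the first one and the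
  first one shifted by 6. In the second phase the copies flip together where they have locally merged,
  that is, where the gap is 0 or 6 around the vertex, and never at the same time elsewhere. This keeps the
  second copy between its barriers (\<open>sandwiched_closed\<close>). The sum of the gaps, weighted by the
  degrees, is a martingale with values between 0 and \<open>12 * (n - 1)\<close>, and the colorings agree when
  it reaches one of these values. Until then some vertex can change it (\<open>ex_active_vertex\<close>), so
  that its quadratic variation is at least \<open>1 / (3 * n)\<close> per step, while
  \<open>x * (12 * (n - 1) - x)\<close> is of order \<open>n ^ 2\<close> at most
  (\<open>sandwich_potential_contracts\<close>).

  Each phase fails with probability at most 1/8. Starting the second copy from the stationary
  distribution, the coupling inequality \<open>tv_dist_map_pmf_le\<close> gives the bound 1/4 on the distance
  to it.
\<close>

section \<open>Markov chains and couplings\<close>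

lemma chain_dist_0 [simp]: "chain_dist K 0 x = return_pmf x"
  by (simp add: chain_dist_def)

lemma chain_dist_add:
  "chain_dist K (s + t) x = bind_pmf (chain_dist K s x) (chain_dist K t)"
proof (induction t)
  case 0
  then show ?case
    by (simp add: bind_return_pmf' chain_dist_def)
next
  case (Suc t)
  have "chain_dist K (Suc r) y = bind_pmf (chain_dist K r y) K" for r y
    by (simp add: chain_dist_def)
  with Suc show ?case
    by (simp add: bind_assoc_pmf)
qed

lemma chain_dist_Suc: "chain_dist K (Suc t) x = bind_pmf (K x) (chain_dist K t)"
  using chain_dist_add[of K 1 t x] by (simp add: chain_dist_def bind_return_pmf)

lemma set_pmf_chain_dist:
  assumes "\<And>y. y \<in> S \<Longrightarrow> set_pmf (K y) \<subseteq> S" "x \<in> S"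
  shows "set_pmf (chain_dist K t x) \<subseteq> S"
  using assms(2)
proof (induction t arbitrary: x)
  case (Suc t)
  then show ?case
    using assms(1) by (auto simp: chain_dist_Suc)
qed auto

lemma stationary_chain_dist:
  assumes "bind_pmf \<pi> K = \<pi>"
  shows "bind_pmf \<pi> (chain_dist K t) = \<pi>"
proof (induction t)
  case (Suc t)
  then show ?case
    using assms by (simp add: chain_dist_Suc bind_assoc_pmf[symmetric] cong: bind_pmf_cong)
qed (simp add: bind_return_pmf')

lemma map_chain_dist:
  assumes closed: "\<And>z. z \<in> S \<Longrightarrow> set_pmf (Q z) \<subseteq> S"
    and step: "\<And>z. z \<in> S \<Longrightarrow> map_pmf p (Q z) = K (p z)"
    and z: "z \<in> S"
  shows "map_pmf p (chain_dist Q t z) = chain_dist K t (p z)"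
  using z
proof (induction t arbitrary: z)
  case (Suc t)
  have "map_pmf p (chain_dist Q (Suc t) z) = bind_pmf (Q z) (\<lambda>w. map_pmf p (chain_dist Q t w))"
    by (simp add: chain_dist_Suc map_bind_pmf)
  also have "\<dots> = bind_pmf (Q z) (\<lambda>w. chain_dist K t (p w))"
    using Suc closed by (intro bind_pmf_cong) auto
  also have "\<dots> = bind_pmf (map_pmf p (Q z)) (chain_dist K t)"
    by (simp add: bind_map_pmf)
  also have "\<dots> = chain_dist K (Suc t) (p z)"
    using step[OF Suc.prems] by (simp add: chain_dist_Suc)
  finally show ?case .
qed (simp add: map_return_pmf)

lemma prob_bind_pmf:
  "measure_pmf.prob (bind_pmf M f) A = measure_pmf.expectation M (\<lambda>x. measure_pmf.prob (f x) A)"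
proof -
  have "measure_pmf.prob N A = pmf (map_pmf (\<lambda>y. y \<in> A) N) True" for N
    by (simp add: pmf_map vimage_def)
  then show ?thesis
    by (simp add: map_bind_pmf pmf_bind)
qed

text \<open>For a run in two stages: the second stage fails with probability at most \<open>c\<close> unless the
  first one ended in \<open>B\<close>.\<close>

lemma prob_bind_pmf_le:
  assumes "\<And>x. x \<in> set_pmf M \<Longrightarrow> x \<notin> B \<Longrightarrow> measure_pmf.prob (f x) A \<le> c" and "c \<ge> 0"
  shows "measure_pmf.prob (bind_pmf M f) A \<le> measure_pmf.prob M B + c"
proof -
  have "measure_pmf.prob (bind_pmf M f) A \<le> measure_pmf.expectation M (\<lambda>x. indicator B x + c)"
    unfolding prob_bind_pmf
  proof (rule integral_mono_AE)
    show "integrable M (\<lambda>x. measure_pmf.prob (f x) A)"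
      by (intro measure_pmf.integrable_const_bound[where B = 1]) auto
    show "AE x in M. measure_pmf.prob (f x) A \<le> indicator B x + c"
      unfolding AE_measure_pmf_iff
    proof
      fix x assume "x \<in> set_pmf M"
      then show "measure_pmf.prob (f x) A \<le> indicator B x + c"
        using assms by (cases "x \<in> B") (auto intro: order.trans[OF measure_pmf.prob_le_1])
    qed
  qed (auto intro!: measure_pmf.integrable_const_bound[where B = "1 + c"] simp: indicator_def assms)
  also have "\<dots> = measure_pmf.prob M B + c"
    by (subst Bochner_Integration.integral_add) (auto simp: measure_pmf.emeasure_eq_measure)
  finally show ?thesis .
qed

text \<open>The coupling inequality. Only the points where \<open>p\<close> and \<open>q\<close> differ contribute, each of
  them once to the value of \<open>p\<close> and once to that of \<open>q\<close>, which cancels the factor 1/2.\<close>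

lemma tv_dist_map_pmf_le:
  assumes "finite S"
  shows "tv_dist S (map_pmf p \<rho>) (map_pmf q \<rho>) \<le> measure_pmf.prob \<rho> {z. p z \<noteq> q z}"
proof -
  let ?P = "measure_pmf.prob \<rho>"
  let ?A = "\<lambda>i. {z. p z = i \<and> q z \<noteq> i}" and ?B = "\<lambda>i. {z. q z = i \<and> p z \<noteq> i}"
  have "\<bar>pmf (map_pmf p \<rho>) i - pmf (map_pmf q \<rho>) i\<bar> \<le> ?P (?A i) + ?P (?B i)" for i
  proof -
    let ?C = "{z. p z = i \<and> q z = i}"
    have "pmf (map_pmf p \<rho>) i = ?P (?A i \<union> ?C)"
      unfolding pmf_map by (rule arg_cong[where f = ?P]) auto
    moreover have "pmf (map_pmf q \<rho>) i = ?P (?B i \<union> ?C)"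
      unfolding pmf_map by (rule arg_cong[where f = ?P]) auto
    moreover have "?P (?A i \<union> ?C) = ?P (?A i) + ?P ?C" "?P (?B i \<union> ?C) = ?P (?B i) + ?P ?C"
      by (subst measure_pmf.finite_measure_Union; auto)+
    ultimately show ?thesis
      using measure_nonneg[of \<rho> "?A i"] measure_nonneg[of \<rho> "?B i"] by linarith
  qed
  then have "(\<Sum>i\<in>S. \<bar>pmf (map_pmf p \<rho>) i - pmf (map_pmf q \<rho>) i\<bar>)
      \<le> (\<Sum>i\<in>S. ?P (?A i)) + (\<Sum>i\<in>S. ?P (?B i))"
    by (simp add: sum_mono flip: sum.distrib)
  moreover have "(\<Sum>i\<in>S. ?P (?A i)) = ?P (\<Union>i\<in>S. ?A i)"
    using assms by (intro measure_pmf.finite_measure_finite_Union[symmetric])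
      (auto simp: disjoint_family_on_def)
  moreover have "(\<Sum>i\<in>S. ?P (?B i)) = ?P (\<Union>i\<in>S. ?B i)"
    using assms by (intro measure_pmf.finite_measure_finite_Union[symmetric])
      (auto simp: disjoint_family_on_def)
  moreover have "?P (\<Union>i\<in>S. ?A i) \<le> ?P {z. p z \<noteq> q z}" "?P (\<Union>i\<in>S. ?B i) \<le> ?P {z. p z \<noteq> q z}"
    by (intro measure_pmf.finite_measure_mono; auto)+
  ultimately show ?thesis
    unfolding tv_dist_def by linarith
qed

text \<open>Iterating the contraction bounds the expected potential at time \<open>t\<close>, and Markov's inequality
  turns this into a bound on the probability of \<open>B\<close>. The induction conditions on the first step and
  does both at once.\<close>

lemma prob_le_contracting_potential:
  fixes \<Phi> :: "'s \<Rightarrow> real"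
  assumes closed: "\<And>z. z \<in> S \<Longrightarrow> set_pmf (Q z) \<subseteq> S"
    and fin: "\<And>z. z \<in> S \<Longrightarrow> finite (set_pmf (Q z))"
    and nonneg: "\<And>z. z \<in> S \<Longrightarrow> \<Phi> z \<ge> 0"
    and bad: "\<And>z. z \<in> S \<Longrightarrow> z \<in> B \<Longrightarrow> \<Phi> z \<ge> 1"
    and contract: "\<And>z. z \<in> S \<Longrightarrow> measure_pmf.expectation (Q z) \<Phi> \<le> r * \<Phi> z"
    and r: "r \<ge> 0" and z: "z \<in> S"
  shows "measure_pmf.prob (chain_dist Q t z) B \<le> r ^ t * \<Phi> z"
  using z
proof (induction t arbitrary: z)
  case 0
  then show ?case
    using nonneg bad by (auto simp: indicator_def)
next
  case (Suc t)
  have "measure_pmf.prob (chain_dist Q (Suc t) z) B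
      = measure_pmf.expectation (Q z) (\<lambda>w. measure_pmf.prob (chain_dist Q t w) B)"
    by (simp add: chain_dist_Suc prob_bind_pmf)
  also have "\<dots> \<le> measure_pmf.expectation (Q z) (\<lambda>w. r ^ t * \<Phi> w)"
    using Suc closed fin
    by (intro integral_mono_AE integrable_measure_pmf_finite) (auto simp: AE_measure_pmf_iff)
  also have "\<dots> = r ^ t * measure_pmf.expectation (Q z) \<Phi>"
    by simp
  also have "\<dots> \<le> r ^ t * (r * \<Phi> z)"
    using contract[OF Suc.prems] r by (intro mult_left_mono) auto
  finally show ?case
    by (simp add: mult_ac)
qed

section \<open>Height functions\<close>

text \<open>At the two ends of the path the missing neighbour is replaced by a copy of the existing one.
  With this convention the same formulas describe the dynamics at every vertex.\<close>

definition lnbr :: "nat \<Rightarrow> nat" where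
  "lnbr v = (if v = 1 then 2 else v - 1)"

definition rnbr :: "nat \<Rightarrow> nat \<Rightarrow> nat" where
  "rnbr n v = (if v = n then n - 1 else Suc v)"

definition heights :: "nat \<Rightarrow> (nat \<Rightarrow> int) set" where
  "heights n = {h. \<forall>i\<in>{1..<n}. \<bar>h (Suc i) - h i\<bar> = 1}"

definition coloring :: "nat \<Rightarrow> (nat \<Rightarrow> int) \<Rightarrow> nat \<Rightarrow> nat" where
  "coloring n h = (\<lambda>i\<in>{1..n}. nat (h i mod 3))"

definition lap :: "nat \<Rightarrow> nat \<Rightarrow> (nat \<Rightarrow> int) \<Rightarrow> int" where
  "lap n v h = h (lnbr v) + h (rnbr n v) - 2 * h v"

text \<open>If the neighbours of \<open>v\<close> are at the same height, this reflects \<open>v\<close> at that height. If they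
  are not, the height of \<open>v\<close> is their mean and nothing changes. Being linear, the formula covers
  both cases without a case distinction.\<close>

definition flip :: "nat \<Rightarrow> nat \<Rightarrow> (nat \<Rightarrow> int) \<Rightarrow> nat \<Rightarrow> int" where
  "flip n v h = h(v := h v + lap n v h)"

lemma nbr_bounds:
  assumes "n \<ge> 2" "v \<in> {1..n}"
  shows "lnbr v \<in> {1..n}" "rnbr n v \<in> {1..n}" "lnbr v \<noteq> v" "rnbr n v \<noteq> v"
  using assms by (auto simp: lnbr_def rnbr_def)

lemma path_adj_iff_nbr:
  assumes "n \<ge> 2" "v \<in> {1..n}"
  shows "path_adj n v w \<longleftrightarrow> w = lnbr v \<or> w = rnbr n v"
  using assms by (auto simp: path_adj_def lnbr_def rnbr_def)

lemma heights_adj: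
  assumes "h \<in> heights n" "path_adj n v w"
  shows "h w = h v + 1 \<or> h w = h v - 1"
proof -
  have step: "h (Suc i) = h i + 1 \<or> h (Suc i) = h i - 1" if "i \<in> {1..<n}" for i
  proof -
    have "\<bar>h (Suc i) - h i\<bar> = 1"
      using assms(1) that by (simp add: heights_def)
    then show ?thesis by linarith
  qed
  show ?thesis
    using assms(2) step[of v] step[of w] by (auto simp: path_adj_def)
qed

lemma heights_nbr:
  assumes "h \<in> heights n" "n \<ge> 2" "v \<in> {1..n}"
  shows "h (lnbr v) = h v + 1 \<or> h (lnbr v) = h v - 1"
    and "h (rnbr n v) = h v + 1 \<or> h (rnbr n v) = h v - 1"
  using heights_adj[OF assms(1)] path_adj_iff_nbr[OF assms(2,3)] by auto

lemma heightsI: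
  assumes "\<And>v w. path_adj n v w \<Longrightarrow> \<bar>h w - h v\<bar> = 1"
  shows "h \<in> heights n"
  using assms by (auto simp: heights_def path_adj_def)

lemma flip_in_heights:
  assumes h: "h \<in> heights n" and n: "n \<ge> 2" and v: "v \<in> {1..n}"
  shows "flip n v h \<in> heights n"
proof (rule heightsI)
  fix u w assume uw: "path_adj n u w"
  then have wu: "path_adj n w u" and ne: "u \<noteq> w"
    by (auto simp: path_adj_def)
  have nbr: "\<bar>flip n v h v - h x\<bar> = 1" if "path_adj n v x" for x
    using that heights_nbr[OF h n v] path_adj_iff_nbr[OF n v] by (auto simp: flip_def lap_def)
  show "\<bar>flip n v h w - flip n v h u\<bar> = 1"
  proof (cases "u = v \<or> w = v")
    case True
    then show ?thesis
      using nbr[of u] nbr[of w] uw wu ne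
      by (auto simp: flip_def abs_minus_commute)
  next
    case False
    then show ?thesis
      using heights_adj[OF h uw] by (auto simp: flip_def)
  qed
qed

lemma mod_3_shift:
  fixes k :: int
  shows "(k + 1) mod 3 = (if k mod 3 = 2 then 0 else k mod 3 + 1)"
    and "(k - 1) mod 3 = (if k mod 3 = 0 then 2 else k mod 3 - 1)"
    and "(k + 2) mod 3 = (if k mod 3 = 0 then 2 else k mod 3 - 1)"
    and "(k - 2) mod 3 = (if k mod 3 = 2 then 0 else k mod 3 + 1)"
proof -
  have "k = k mod 3 + k div 3 * 3" "k mod 3 = 0 \<or> k mod 3 = 1 \<or> k mod 3 = 2"
    using pos_mod_bound[of 3 k] pos_mod_sign[of 3 k] by simp linarith
  then obtain q r where k: "k = r + q * 3" "r = 0 \<or> r = 1 \<or> r = 2"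
    by (rule that)
  show 1: "(k + 1) mod 3 = (if k mod 3 = 2 then 0 else k mod 3 + 1)"
    unfolding k(1) using k(2) by (elim disjE) simp_all
  show 2: "(k + 2) mod 3 = (if k mod 3 = 0 then 2 else k mod 3 - 1)"
    unfolding k(1) using k(2) by (elim disjE) simp_all
  show "(k - 1) mod 3 = (if k mod 3 = 0 then 2 else k mod 3 - 1)"
    using 2 mod_add_self2[of "k - 1" 3] by (simp add: algebra_simps)
  show "(k - 2) mod 3 = (if k mod 3 = 2 then 0 else k mod 3 + 1)"
    using 1 mod_add_self2[of "k - 2" 3] by (simp add: algebra_simps)
qed

lemma mod_3_step:
  fixes x y a :: int
  assumes "0 \<le> x" "x < 3" "0 \<le> y" "y < 3" "x \<noteq> y" "a mod 3 = x"
  shows "(a + (if (y - x) mod 3 = 1 then 1 else - 1)) mod 3 = y"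
proof -
  have "x = 0 \<or> x = 1 \<or> x = 2" "y = 0 \<or> y = 1 \<or> y = 2"
    using assms by linarith+
  then show ?thesis
    using assms(5,6) by (elim disjE) (simp_all add: mod_3_shift)
qed

text \<open>Here \<open>k\<close> is the height of a vertex, \<open>a\<close> and \<open>b\<close> are those of its neighbours, and
  \<open>c\<close> is the proposed color. Only if the neighbours are at the same height is there an acceptable
  color other than the current one, namely that of the reflected height.\<close>

lemma admissible_color_mod_3:
  fixes a b k c :: int
  assumes ab: "a = k + 1 \<or> a = k - 1" "b = k + 1 \<or> b = k - 1" and c: "0 \<le> c" "c < 3"
  shows "(c \<noteq> a mod 3 \<and> c \<noteq> b mod 3 \<and> c \<noteq> k mod 3) \<longleftrightarrow> (a = b \<and> c = (a + b - k) mod 3)"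
    and "c = (a + b - k) mod 3 \<Longrightarrow> c \<noteq> a mod 3 \<and> c \<noteq> b mod 3"
proof -
  have r: "k mod 3 = 0 \<or> k mod 3 = 1 \<or> k mod 3 = 2"
    using pos_mod_bound[of 3 k] pos_mod_sign[of 3 k] by linarith
  have rc: "c = 0 \<or> c = 1 \<or> c = 2"
    using c by linarith
  have "((c \<noteq> a mod 3 \<and> c \<noteq> b mod 3 \<and> c \<noteq> k mod 3) \<longleftrightarrow> (a = b \<and> c = (a + b - k) mod 3))
     \<and> (c = (a + b - k) mod 3 \<longrightarrow> c \<noteq> a mod 3 \<and> c \<noteq> b mod 3)"
    using ab r rc by (elim disjE) (simp_all add: mod_3_shift)
  then show "(c \<noteq> a mod 3 \<and> c \<noteq> b mod 3 \<and> c \<noteq> k mod 3) \<longleftrightarrow> (a = b \<and> c = (a + b - k) mod 3)"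
    and "c = (a + b - k) mod 3 \<Longrightarrow> c \<noteq> a mod 3 \<and> c \<noteq> b mod 3"
    by auto
qed

text \<open>Every proper coloring lifts: consecutive colors differ by 1 or by -1 modulo 3, and summing
  these differences gives a height function.\<close>

lemma ex_height_lift:
  assumes x: "x \<in> proper_colorings 3 n"
  obtains h where "h \<in> heights n" "coloring n h = x"
proof -
  define s :: "nat \<Rightarrow> int" where
    "s j = (if (int (x (Suc j)) - int (x j)) mod 3 = 1 then 1 else - 1)" for j
  define h where "h i = int (x 1) + (\<Sum>j\<in>{1..<i}. s j)" for i
  have lt: "x i < 3" if "i \<in> {1..n}" for i
    using x that by (auto simp: proper_colorings_def)
  have Suc: "h (Suc i) = h i + s i" if "i \<ge> 1" for i
    using that by (simp add: h_def)
  have mod: "h i mod 3 = int (x i)" if "1 \<le> i" "i \<le> n" for i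
    using that
  proof (induction i rule: dec_induct)
    case base
    then show ?case using lt[of 1] by (simp add: h_def)
  next
    case (step i)
    have "x i \<noteq> x (Suc i)"
      using x step by (auto simp: proper_colorings_def path_adj_def)
    moreover have "x i < 3" "x (Suc i) < 3"
      using lt[of i] lt[of "Suc i"] step by auto
    moreover have "h i mod 3 = int (x i)"
      using step by simp
    ultimately show ?case
      unfolding Suc[OF step(1)] s_def by (intro mod_3_step) auto
  qed
  have "h \<in> heights n"
    using Suc by (auto simp: heights_def s_def)
  moreover have "coloring n h = x"
  proof
    fix i show "coloring n h i = x i"
      using mod[of i] x
      by (cases "i \<in> {1..n}") (auto simp: coloring_def proper_colorings_def PiE_def extensional_def)
  qed
  ultimately show thesis by (rule that)
qed

lemma map_pmf_of_set_if_eq: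
  assumes "finite A" "i \<in> A" "j \<in> A"
  shows "map_pmf (\<lambda>u. if u = i then a else b) (pmf_of_set A) =
    map_pmf (\<lambda>u. if u = j then a else b) (pmf_of_set A)"
proof -
  let ?f = "id(i := j, j := i)"
  have "bij_betw ?f A A"
    using assms by (intro bij_betwI[where g = ?f]) auto
  then have "map_pmf ?f (pmf_of_set A) = pmf_of_set A"
    using assms by (intro map_pmf_of_set_bij_betw) auto
  then have "map_pmf (\<lambda>u. if u = i then a else b) (pmf_of_set A) =
      map_pmf (\<lambda>u. if u = i then a else b) (map_pmf ?f (pmf_of_set A))"
    by simp
  also have "\<dots> = map_pmf (\<lambda>u. if u = j then a else b) (pmf_of_set A)"
    unfolding pmf.map_comp by (rule arg_cong[where f = "\<lambda>g. map_pmf g (pmf_of_set A)"]) auto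
  finally show ?thesis .
qed

text \<open>The one color that can change the coloring at \<open>v\<close> is proposed with probability
  1/3. It is immaterial which of the three outcomes of the random choice stands for it, and
  this freedom is what the couplings use.\<close>

lemma metropolis_coloring:
  fixes j :: nat
  assumes h: "h \<in> heights n" and n: "n \<ge> 2" and v: "v \<in> {1..n}" and j: "j < 3"
  shows "metropolis 3 n v (coloring n h) =
    map_pmf (\<lambda>u. if u = j then coloring n (flip n v h) else coloring n h) (pmf_of_set {0..<3})"
proof -
  note nbr = heights_nbr[OF h n v] nbr_bounds[OF n v]
  define c0 where "c0 = nat (flip n v h v mod 3)"
  have c0: "c0 < 3"
    by (simp add: c0_def nat_less_iff)
  have c0': "int c0 = (h (lnbr v) + h (rnbr n v) - h v) mod 3"
    by (simp add: c0_def flip_def lap_def algebra_simps)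
  have col: "coloring n h w = nat (h w mod 3)" if "w \<in> {1..n}" for w
    using that by (simp add: coloring_def)
  have flip: "(coloring n h)(v := c0) = coloring n (flip n v h)"
    using v by (auto simp: fun_eq_iff coloring_def c0_def flip_def)
  have "(if \<forall>w. path_adj n v w \<longrightarrow> coloring n h w \<noteq> c then (coloring n h)(v := c) else coloring n h)
      = (if c = c0 then coloring n (flip n v h) else coloring n h)" if c: "c < 3" for c
  proof -
    have acc: "(\<forall>w. path_adj n v w \<longrightarrow> coloring n h w \<noteq> c) \<longleftrightarrow>
        h (lnbr v) mod 3 \<noteq> int c \<and> h (rnbr n v) mod 3 \<noteq> int c"
      using nbr c by (auto simp: path_adj_iff_nbr[OF n v] col nat_eq_iff)
    have same: "(coloring n h)(v := c) = coloring n h" if "h v mod 3 = int c"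
      using that v by (auto simp: fun_eq_iff coloring_def)
    note adm = admissible_color_mod_3[OF nbr(1,2), of "int c", folded c0']
    show ?thesis
      using adm same c unfolding acc flip[symmetric] by auto
  qed
  then have "metropolis 3 n v (coloring n h) =
      map_pmf (\<lambda>c. if c = c0 then coloring n (flip n v h) else coloring n h) (pmf_of_set {0..<3})"
    unfolding metropolis_def by (intro map_pmf_cong) auto
  also have "\<dots> = map_pmf (\<lambda>u. if u = j then coloring n (flip n v h) else coloring n h)
      (pmf_of_set {0..<3})"
    using c0 j by (intro map_pmf_of_set_if_eq) auto
  finally show ?thesis .
qed

section \<open>A family of couplings\<close>

text \<open>Both copies choose the same vertex. The first one flips it on outcome 0. The second one flips
  it on the same outcome if the rule \<open>C\<close> says so, and otherwise on outcome 1, so that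
  at most one of the two moves. The rule may depend on the states, since the law of the second copy
  does not depend on which outcome makes it move.\<close>

type_synonym height_pair = "(nat \<Rightarrow> int) \<times> (nat \<Rightarrow> int)"

definition coupled_move ::
  "nat \<Rightarrow> (nat \<Rightarrow> height_pair \<Rightarrow> bool) \<Rightarrow> nat \<Rightarrow> nat \<Rightarrow> height_pair \<Rightarrow> height_pair" where
  "coupled_move n C v u z =
     (if u = 0 then flip n v (fst z) else fst z,
      if u = (if C v z then 0 else 1) then flip n v (snd z) else snd z)"

definition coupling ::
  "nat \<Rightarrow> (nat \<Rightarrow> height_pair \<Rightarrow> bool) \<Rightarrow> height_pair \<Rightarrow> height_pair pmf" where
  "coupling n C z = bind_pmf (pmf_of_set {1..n})
     (\<lambda>v. map_pmf (\<lambda>u. coupled_move n C v u z) (pmf_of_set {0..<3}))"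

lemma set_pmf_coupling:
  assumes "n \<ge> 1"
  shows "set_pmf (coupling n C z) = (\<Union>v\<in>{1..n}. (\<lambda>u. coupled_move n C v u z) ` {0..<3})"
  using assms by (simp add: coupling_def)

lemma finite_set_pmf_coupling:
  assumes "n \<ge> 1"
  shows "finite (set_pmf (coupling n C z))"
  using assms by (simp add: set_pmf_coupling)

lemma coupling_closed_heights:
  assumes "n \<ge> 2" "z \<in> heights n \<times> heights n"
  shows "set_pmf (coupling n C z) \<subseteq> heights n \<times> heights n"
  using assms by (auto simp: set_pmf_coupling coupled_move_def intro!: flip_in_heights)

text \<open>The change of \<open>f\<close> summed over the three equally likely outcomes at \<open>v\<close>.\<close>

definition vertex_drift ::
  "nat \<Rightarrow> (nat \<Rightarrow> height_pair \<Rightarrow> bool) \<Rightarrow> (height_pair \<Rightarrow> real) \<Rightarrow> nat \<Rightarrow> height_pair \<Rightarrow> real" where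
  "vertex_drift n C f v z =
     (if C v z then f (flip n v (fst z), flip n v (snd z)) - f z
      else f (flip n v (fst z), snd z) + f (fst z, flip n v (snd z)) - 2 * f z)"

lemma expectation_coupling:
  assumes n: "n \<ge> 1"
  shows "measure_pmf.expectation (coupling n C z) f =
    f z + (\<Sum>v\<in>{1..n}. vertex_drift n C f v z) / (3 * real n)"
proof -
  have 3: "{0..<3::nat} = {0, 1, 2}" by auto
  have outcomes: "measure_pmf.expectation (map_pmf (\<lambda>u. coupled_move n C v u z) (pmf_of_set {0..<3})) f
      = f z + vertex_drift n C f v z / 3" for v
  proof -
    have "measure_pmf.expectation (map_pmf (\<lambda>u. coupled_move n C v u z) (pmf_of_set {0..<3})) f
        = (\<Sum>u\<in>{0..<3}. f (coupled_move n C v u z)) / 3"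
      by (subst integral_map_pmf, subst integral_pmf_of_set) auto
    also have "(\<Sum>u\<in>{0..<3}. f (coupled_move n C v u z)) = 3 * f z + vertex_drift n C f v z"
      unfolding 3 by (simp add: coupled_move_def vertex_drift_def)
    finally show ?thesis
      by (simp add: add_divide_distrib)
  qed
  have "measure_pmf.expectation (coupling n C z) f =
      (\<Sum>v\<in>{1..n}. (f z + vertex_drift n C f v z / 3) / real n)"
    unfolding coupling_def using n
    by (subst pmf_expectation_bind_pmf_of_set) (simp_all only: outcomes, simp_all add: field_simps)
  also have "\<dots> = (\<Sum>v\<in>{1..n}. f z + vertex_drift n C f v z / 3) / real n"
    by (rule sum_divide_distrib[symmetric])
  also have "(\<Sum>v\<in>{1..n}. f z + vertex_drift n C f v z / 3) =
      real n * f z + (\<Sum>v\<in>{1..n}. vertex_drift n C f v z) / 3"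
    by (simp only: sum.distrib sum_divide_distrib) simp
  also have "\<dots> / real n = f z + (\<Sum>v\<in>{1..n}. vertex_drift n C f v z) / (3 * real n)"
    using n by (simp add: add_divide_distrib)
  finally show ?thesis .
qed

lemma coupling_marginals:
  assumes n: "n \<ge> 2" and z: "z \<in> heights n \<times> heights n"
  shows "map_pmf (\<lambda>w. coloring n (fst w)) (coupling n C z) = glauber 3 n (coloring n (fst z))"
    and "map_pmf (\<lambda>w. coloring n (snd w)) (coupling n C z) = glauber 3 n (coloring n (snd z))"
proof -
  have z': "fst z \<in> heights n" "snd z \<in> heights n" and vs: "set_pmf (pmf_of_set {1..n}) = {1..n}"
    using z n by auto
  have "map_pmf (\<lambda>u. coloring n (fst (coupled_move n C v u z))) (pmf_of_set {0..<3})
      = metropolis 3 n v (coloring n (fst z))"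
    and "map_pmf (\<lambda>u. coloring n (snd (coupled_move n C v u z))) (pmf_of_set {0..<3})
      = metropolis 3 n v (coloring n (snd z))" if v: "v \<in> {1..n}" for v
  proof -
    show "map_pmf (\<lambda>u. coloring n (fst (coupled_move n C v u z))) (pmf_of_set {0..<3})
        = metropolis 3 n v (coloring n (fst z))"
      by (subst metropolis_coloring[OF z'(1) n v, where j = 0])
         (auto simp: coupled_move_def intro!: map_pmf_cong)
    show "map_pmf (\<lambda>u. coloring n (snd (coupled_move n C v u z))) (pmf_of_set {0..<3})
        = metropolis 3 n v (coloring n (snd z))"
      by (subst metropolis_coloring[OF z'(2) n v, where j = "if C v z then 0 else 1"])
         (auto simp: coupled_move_def intro!: map_pmf_cong)
  qed
  then show "map_pmf (\<lambda>w. coloring n (fst w)) (coupling n C z) = glauber 3 n (coloring n (fst z))"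
    and "map_pmf (\<lambda>w. coloring n (snd w)) (coupling n C z) = glauber 3 n (coloring n (snd z))"
    unfolding coupling_def glauber_def map_bind_pmf pmf.map_comp comp_def
    by (intro bind_pmf_cong refl; simp only: vs)+
qed

lemma chain_coupling_marginals:
  assumes "n \<ge> 2" "z \<in> heights n \<times> heights n"
  shows "map_pmf (\<lambda>w. coloring n (fst w)) (chain_dist (coupling n C) t z) =
      chain_dist (glauber 3 n) t (coloring n (fst z))"
    and "map_pmf (\<lambda>w. coloring n (snd w)) (chain_dist (coupling n C) t z) =
      chain_dist (glauber 3 n) t (coloring n (snd z))"
  using assms
  by (intro map_chain_dist[where S = "heights n \<times> heights n"] coupling_closed_heights
      coupling_marginals; simp)+

section \<open>Coupling the gradients\<close>

definition slope :: "(nat \<Rightarrow> int) \<Rightarrow> nat \<Rightarrow> int" where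
  "slope h i = h (Suc i) - h i"

text \<open>A flip inside the path exchanges the two slopes that meet at the vertex, and a flip at an end
  reverses the only slope there: the slopes perform an exclusion process with reservoirs.\<close>

lemma slope_flip:
  assumes "n \<ge> 2" "v \<in> {1..n}" "i \<in> {1..<n}"
  shows "slope (flip n v h) i =
    (if i = v then if v = 1 then - slope h 1 else slope h (v - 1)
     else if Suc i = v then if v = n then - slope h (n - 1) else slope h v
     else slope h i)"
  using assms by (auto simp: slope_def flip_def lap_def lnbr_def rnbr_def numeral_2_eq_2)

lemma slope_cases:
  assumes "h \<in> heights n" "i \<in> {1..<n}"
  shows "slope h i = 1 \<or> slope h i = - 1"
proof -
  have "\<bar>slope h i\<bar> = 1"
    using assms by (auto simp: heights_def slope_def)
  then show ?thesis by linarith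
qed

definition mismatch :: "nat \<Rightarrow> height_pair \<Rightarrow> nat \<Rightarrow> real" where
  "mismatch n z i = of_bool (i \<in> {1..<n} \<and> slope (fst z) i \<noteq> slope (snd z) i)"

text \<open>Inside the path both copies always flip together, so that each mismatch performs a random
  walk. At the ends a mismatch is treated in the opposite way: whichever copy flips alone removes
  it.\<close>

definition stirring :: "nat \<Rightarrow> nat \<Rightarrow> height_pair \<Rightarrow> bool" where
  "stirring n v z \<longleftrightarrow>
     (v = 1 \<longrightarrow> mismatch n z 1 = 0) \<and> (v = n \<longrightarrow> mismatch n z (n - 1) = 0)"

text \<open>The weight is the expected absorption time of the simple random walk on \<open>{0..n}\<close>.\<close>

definition mismatch_potential :: "nat \<Rightarrow> height_pair \<Rightarrow> real" where
  "mismatch_potential n z = (\<Sum>i\<in>{1..<n}. real i * (real n - real i) * mismatch n z i)"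

lemma mismatch_bounds: "mismatch n z i \<ge> 0" "mismatch n z i \<le> 1"
  by (auto simp: mismatch_def)

lemma weighted_sum_fun_upd:
  fixes f w :: "'a \<Rightarrow> 'b :: comm_ring"
  assumes "finite A" "a \<in> A"
  shows "(\<Sum>i\<in>A. w i * (f(a := x)) i) = (\<Sum>i\<in>A. w i * f i) + w a * (x - f a)"
proof -
  have "(\<Sum>i\<in>A. w i * (f(a := x)) i) = w a * x + (\<Sum>i\<in>A - {a}. w i * (f(a := x)) i)"
    using assms by (subst sum.remove) auto
  also have "(\<Sum>i\<in>A - {a}. w i * (f(a := x)) i) = (\<Sum>i\<in>A - {a}. w i * f i)"
    by (rule sum.cong) auto
  also have "\<dots> = (\<Sum>i\<in>A. w i * f i) - w a * f a"
    using assms by (subst sum.remove[of A a]) auto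
  finally show ?thesis
    by (simp add: algebra_simps)
qed

lemma mismatch_potential_update:
  assumes "mismatch n w = (mismatch n z)(a := x)" "a \<in> {1..<n}"
  shows "mismatch_potential n w =
    mismatch_potential n z + real a * (real n - real a) * (x - mismatch n z a)"
  unfolding mismatch_potential_def assms(1) using assms(2) by (intro weighted_sum_fun_upd) auto

lemma mismatch_potential_swap:
  assumes "mismatch n w = (mismatch n z)(a := mismatch n z b, b := mismatch n z a)"
    and "a \<in> {1..<n}" "b \<in> {1..<n}" "a \<noteq> b"
  shows "mismatch_potential n w = mismatch_potential n z +
    (real a * (real n - real a) - real b * (real n - real b)) * (mismatch n z b - mismatch n z a)"
  unfolding mismatch_potential_def assms(1) using assms(2-)
  by (subst weighted_sum_fun_upd, simp, simp)+ (simp add: algebra_simps)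

lemma mismatch_flip_both:
  assumes n: "n \<ge> 2" and v: "v \<in> {1..n}"
  shows "mismatch n (flip n v (fst z), flip n v (snd z)) =
    (if v = 1 \<or> v = n then mismatch n z
     else (mismatch n z)(v - 1 := mismatch n z v, v := mismatch n z (v - 1)))"
proof
  fix i
  show "mismatch n (flip n v (fst z), flip n v (snd z)) i =
    (if v = 1 \<or> v = n then mismatch n z
     else (mismatch n z)(v - 1 := mismatch n z v, v := mismatch n z (v - 1))) i"
  proof (cases "i \<in> {1..<n}")
    case True
    note flip = slope_flip[OF n v True]
    consider "v = 1" | "v = n" | "v \<noteq> 1" "v \<noteq> n" "i = v" | "v \<noteq> 1" "v \<noteq> n" "Suc i = v"
      | "v \<noteq> 1" "v \<noteq> n" "i \<noteq> v" "Suc i \<noteq> v"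
      by blast
    then show ?thesis
    proof cases
      case 1
      then show ?thesis
        unfolding mismatch_def fst_conv snd_conv flip using True by (simp add: mismatch_def)
    next
      case 2
      then have "i = n - 1 \<longleftrightarrow> Suc i = v" using True by auto
      then show ?thesis
        unfolding mismatch_def fst_conv snd_conv flip using True 2 by (auto simp: mismatch_def)
    next
      case 3
      then show ?thesis
        unfolding mismatch_def fst_conv snd_conv flip using True v by (auto simp: mismatch_def)
    next
      case 4
      then show ?thesis
        unfolding mismatch_def fst_conv snd_conv flip using True v by (auto simp: mismatch_def)
    next
      case 5
      then have "i \<noteq> v - 1" using v by auto
      then show ?thesis
        unfolding mismatch_def fst_conv snd_conv flip using 5 by (simp add: mismatch_def)
    qed
  next
    case False
    then have "mismatch n w i = 0" for w
      unfolding mismatch_def by auto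
    then show ?thesis
      using v False by (cases "v = 1 \<or> v = n") auto
  qed
qed

lemma mismatch_flip_one_at_end:
  assumes n: "n \<ge> 2" and z: "z \<in> heights n \<times> heights n"
    and v: "v = 1 \<and> a = 1 \<or> v = n \<and> a = n - 1" and m: "mismatch n z a \<noteq> 0"
  shows "mismatch n (flip n v (fst z), snd z) = (mismatch n z)(a := 0)"
    and "mismatch n (fst z, flip n v (snd z)) = (mismatch n z)(a := 0)"
proof -
  have v': "v \<in> {1..n}" and a: "a \<in> {1..<n}"
    using v n by auto
  have hg: "fst z \<in> heights n" "snd z \<in> heights n"
    using z by auto
  have flip: "slope (flip n v h) i = (if i = a then - slope h i else slope h i)"
    if "i \<in> {1..<n}" for h i
    using v n that by (auto simp: slope_flip[OF n v' that])
  have opp: "slope (snd z) a = - slope (fst z) a"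
    using m slope_cases[OF hg(1) a] slope_cases[OF hg(2) a]
    by (auto simp: mismatch_def split: if_splits)
  have "mismatch n (flip n v (fst z), snd z) i = ((mismatch n z)(a := 0)) i \<and>
      mismatch n (fst z, flip n v (snd z)) i = ((mismatch n z)(a := 0)) i" for i
    using opp flip by (cases "i \<in> {1..<n}") (auto simp: mismatch_def)
  then show "mismatch n (flip n v (fst z), snd z) = (mismatch n z)(a := 0)"
    and "mismatch n (fst z, flip n v (snd z)) = (mismatch n z)(a := 0)"
    by auto
qed

text \<open>A mismatch that jumps from \<open>v\<close> to \<open>v - 1\<close> changes its weight \<open>i * (n - i)\<close> by
  \<open>2 * v - 1 - n\<close>. The ends obey the same bound, with absorbing positions 0 and \<open>n\<close> of weight
  0, because a mismatch there is removed at twice the rate at which it would jump.\<close>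

lemma vertex_drift_mismatch_potential:
  assumes n: "n \<ge> 2" and z: "z \<in> heights n \<times> heights n" and v: "v \<in> {1..n}"
  shows "vertex_drift n (stirring n) (mismatch_potential n) v z \<le>
    (mismatch n z v - mismatch n z (v - 1)) * (2 * real v - 1 - real n)"
proof -
  let ?m = "mismatch n z"
  have out: "?m 0 = 0" "?m n = 0"
    by (auto simp: mismatch_def)
  show ?thesis
  proof (cases "stirring n v z")
    case True
    then have *: "vertex_drift n (stirring n) (mismatch_potential n) v z =
        mismatch_potential n (flip n v (fst z), flip n v (snd z)) - mismatch_potential n z"
      by (simp add: vertex_drift_def)
    show ?thesis
    proof (cases "v = 1 \<or> v = n")
      case boundary: True
      then have "mismatch_potential n (flip n v (fst z), flip n v (snd z)) = mismatch_potential n z"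
        using mismatch_flip_both[OF n v, of z] by (simp add: mismatch_potential_def)
      moreover have "?m v = 0" "?m (v - 1) = 0"
        using True boundary out by (auto simp: stirring_def)
      ultimately show ?thesis
        unfolding * by simp
    next
      case False
      then have "mismatch_potential n (flip n v (fst z), flip n v (snd z)) = mismatch_potential n z +
          (real (v - 1) * (real n - real (v - 1)) - real v * (real n - real v)) * (?m v - ?m (v - 1))"
        using v by (intro mismatch_potential_swap) (auto simp: mismatch_flip_both[OF n v])
      moreover have "real (v - 1) = real v - 1"
        using v by auto
      ultimately show ?thesis
        unfolding * by (simp add: algebra_simps)
    qed
  next
    case False
    then obtain a where va: "v = 1 \<and> a = 1 \<or> v = n \<and> a = n - 1" and m: "?m a \<noteq> 0"
      by (auto simp: stirring_def)
    have a: "a \<in> {1..<n}" and m1: "?m a = 1"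
      using va n m by (auto simp: mismatch_def)
    have w: "real a * (real n - real a) = real n - 1"
      using va n by auto
    have "mismatch_potential n (flip n v (fst z), snd z) = mismatch_potential n z - (real n - 1)"
      and "mismatch_potential n (fst z, flip n v (snd z)) = mismatch_potential n z - (real n - 1)"
      using mismatch_potential_update[OF mismatch_flip_one_at_end(1)[OF n z va m] a]
        mismatch_potential_update[OF mismatch_flip_one_at_end(2)[OF n z va m] a] m1 w
      by auto
    then have "vertex_drift n (stirring n) (mismatch_potential n) v z = - 2 * (real n - 1)"
      using False by (simp add: vertex_drift_def)
    moreover have "(?m v - ?m (v - 1)) * (2 * real v - 1 - real n) = - (real n - 1)"
      using va m1 out by auto
    ultimately show ?thesis
      using n by simp
  qed
qed

text \<open>The weight has second difference -2 everywhere, and so every mismatch lowers the expected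
  potential by the same amount.\<close>

lemma sum_mismatch_by_parts:
  "(\<Sum>v\<in>{1..k}. (mismatch n z v - mismatch n z (v - 1)) * (2 * real v - 1 - real n)) =
    mismatch n z k * (2 * real k + 1 - real n) - 2 * (\<Sum>i\<in>{1..k}. mismatch n z i)"
proof (induction k)
  case 0
  show ?case by (simp add: mismatch_def)
next
  case (Suc k)
  then show ?case by (simp add: algebra_simps)
qed

lemma mismatch_potential_le:
  "mismatch_potential n z \<le> real n ^ 2 * (\<Sum>i\<in>{1..<n}. mismatch n z i)"
  unfolding mismatch_potential_def sum_distrib_left
proof (intro sum_mono mult_right_mono mismatch_bounds)
  fix i assume "i \<in> {1..<n}"
  then show "real i * (real n - real i) \<le> real n ^ 2"
    unfolding power2_eq_square by (intro mult_mono) auto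
qed

lemma mismatch_potential_nonneg: "mismatch_potential n z \<ge> 0"
  unfolding mismatch_potential_def
  by (intro sum_nonneg mult_nonneg_nonneg mismatch_bounds) auto

lemma mismatch_potential_le_cube: "mismatch_potential n z \<le> real n ^ 3"
proof -
  have "(\<Sum>i\<in>{1..<n}. mismatch n z i) \<le> (\<Sum>i\<in>{1..<n}. 1)"
    by (intro sum_mono mismatch_bounds)
  also have "\<dots> \<le> real n"
    by simp
  finally have "real n ^ 2 * (\<Sum>i\<in>{1..<n}. mismatch n z i) \<le> real n ^ 2 * real n"
    by (intro mult_left_mono) auto
  then show ?thesis
    using mismatch_potential_le[of n z] by (simp add: power3_eq_cube power2_eq_square)
qed

lemma mismatch_potential_ge_1:
  assumes "i \<in> {1..<n}" "slope (fst z) i \<noteq> slope (snd z) i"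
  shows "mismatch_potential n z \<ge> 1"
proof -
  have "1 \<le> real i * (real n - real i)"
    using assms(1) mult_mono[of 1 "real i" 1 "real n - real i"] by auto
  also have "\<dots> = real i * (real n - real i) * mismatch n z i"
    using assms by (simp add: mismatch_def)
  also have "\<dots> \<le> mismatch_potential n z"
    unfolding mismatch_potential_def using assms(1)
    by (intro member_le_sum) (auto intro!: mult_nonneg_nonneg mismatch_bounds)
  finally show ?thesis .
qed

lemma mismatch_potential_contracts:
  assumes n: "n \<ge> 2" and z: "z \<in> heights n \<times> heights n"
  shows "measure_pmf.expectation (coupling n (stirring n) z) (mismatch_potential n)
    \<le> (1 - 2 / (3 * real n ^ 3)) * mismatch_potential n z"
proof -
  let ?s = "\<Sum>i\<in>{1..<n}. mismatch n z i"
  have "(\<Sum>v\<in>{1..n}. vertex_drift n (stirring n) (mismatch_potential n) v z) \<le>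
      (\<Sum>v\<in>{1..n}. (mismatch n z v - mismatch n z (v - 1)) * (2 * real v - 1 - real n))"
    using vertex_drift_mismatch_potential[OF n z] by (intro sum_mono)
  also have "\<dots> = - 2 * (\<Sum>i\<in>{1..n}. mismatch n z i)"
    by (subst sum_mismatch_by_parts) (simp add: mismatch_def)
  also have "(\<Sum>i\<in>{1..n}. mismatch n z i) = ?s"
    by (rule sum.mono_neutral_right) (auto simp: mismatch_def)
  also have "- 2 * ?s \<le> - 2 * (mismatch_potential n z / real n ^ 2)"
    using mismatch_potential_le[of n z] n by (simp add: field_simps)
  finally have "(\<Sum>v\<in>{1..n}. vertex_drift n (stirring n) (mismatch_potential n) v z) / (3 * real n)
      \<le> - 2 * (mismatch_potential n z / real n ^ 2) / (3 * real n)"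
    by (intro divide_right_mono) auto
  also have "\<dots> = - (2 / (3 * real n ^ 3)) * mismatch_potential n z"
    by (simp add: power3_eq_cube power2_eq_square)
  finally show ?thesis
    using n by (simp add: expectation_coupling algebra_simps)
qed

section \<open>Merging colorings that differ by a rotation of the colors\<close>

abbreviation gap :: "height_pair \<Rightarrow> nat \<Rightarrow> int" where
  "gap z v \<equiv> snd z v - fst z v"

text \<open>A gap of 0 or 6 along the whole path means that the colorings agree: 6 is the least even
  multiple of 3, and flips preserve the parity of the gap.\<close>

definition sandwiched :: "nat \<Rightarrow> height_pair set" where
  "sandwiched n = {z \<in> heights n \<times> heights n. \<forall>v\<in>{1..n}. gap z v \<in> {0, 2, 4, 6}}"

definition locally_merged :: "nat \<Rightarrow> nat \<Rightarrow> height_pair \<Rightarrow> bool" where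
  "locally_merged n v z \<longleftrightarrow>
     (\<exists>c\<in>{0, 6}. gap z v = c \<and> gap z (lnbr v) = c \<and> gap z (rnbr n v) = c)"

definition apart :: "nat \<Rightarrow> height_pair \<Rightarrow> bool" where
  "apart n z \<longleftrightarrow> (\<exists>v\<in>{1..n}. gap z v \<noteq> 0) \<and> (\<exists>v\<in>{1..n}. gap z v \<noteq> 6)"

lemma apart_if_colorings_differ:
  assumes "coloring n (fst z) \<noteq> coloring n (snd z)"
  shows "apart n z"
proof (rule ccontr)
  assume "\<not> apart n z"
  then consider "\<forall>v\<in>{1..n}. gap z v = 0" | "\<forall>v\<in>{1..n}. gap z v = 6"
    unfolding apart_def by blast
  then have "snd z v mod 3 = fst z v mod 3" if "v \<in> {1..n}" for v
  proof cases
    case 2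
    then have "snd z v = fst z v + 2 * 3"
      using that by fastforce
    then show ?thesis
      by (simp only: mod_mult_self1)
  qed (use that in auto)
  then show False
    using assms by (auto simp: coloring_def)
qed

text \<open>A lone flip changes the gap by at most 2, hence it can leave the sandwich only from a gap of 0 or 6.
  Suppose that the gap at the vertex is 0 and the lower copy has a local minimum there, so that it
  could move up. The neighbours in the upper copy are at least as high, so this copy has the same local
  minimum, and the gap is 0 all around. The other cases are symmetric.\<close>

lemma gap_after_lone_flip:
  fixes a b k a' b' k' :: int
  assumes "a = k + 1 \<or> a = k - 1" "b = k + 1 \<or> b = k - 1"
    and "a' = k' + 1 \<or> a' = k' - 1" "b' = k' + 1 \<or> b' = k' - 1"
    and "k' - k \<in> {0, 2, 4, 6}" "a' - a \<in> {0, 2, 4, 6}" "b' - b \<in> {0, 2, 4, 6}"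
    and "\<not> (\<exists>c\<in>{0, 6}. k' - k = c \<and> a' - a = c \<and> b' - b = c)"
  shows "k' - (a + b - k) \<in> {0, 2, 4, 6}" "(a' + b' - k') - k \<in> {0, 2, 4, 6}"
proof -
  obtain d where d: "k' = k + d" "d = 0 \<or> d = 2 \<or> d = 4 \<or> d = 6"
    using assms(5) by (intro that[of "k' - k"]) auto
  have "k' - (a + b - k) \<in> {0, 2, 4, 6} \<and> (a' + b' - k') - k \<in> {0, 2, 4, 6}"
    using d(2) assms(1-4,6-8) unfolding d(1) by (elim disjE; simp)
  then show "k' - (a + b - k) \<in> {0, 2, 4, 6}" "(a' + b' - k') - k \<in> {0, 2, 4, 6}"
    by auto
qed

lemma sandwiched_closed:
  assumes n: "n \<ge> 2" and z: "z \<in> sandwiched n"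
  shows "set_pmf (coupling n (locally_merged n) z) \<subseteq> sandwiched n"
proof
  fix w assume w: "w \<in> set_pmf (coupling n (locally_merged n) z)"
  then obtain v u where v: "v \<in> {1..n}" and wu: "w = coupled_move n (locally_merged n) v u z"
    using n by (auto simp: set_pmf_coupling)
  have zh: "z \<in> heights n \<times> heights n" and hg: "fst z \<in> heights n" "snd z \<in> heights n"
    and gaps: "\<And>i. i \<in> {1..n} \<Longrightarrow> gap z i \<in> {0, 2, 4, 6}"
    using z by (auto simp: sandwiched_def)
  have "gap w i \<in> {0, 2, 4, 6}" if i: "i \<in> {1..n}" for i
  proof (cases "i = v")
    case False
    then show ?thesis
      using gaps[OF i] by (simp add: wu coupled_move_def flip_def)
  next
    case True
    note nb = nbr_bounds[OF n v]
    let ?h = "fst z" and ?g = "snd z"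
    have flip: "flip n v h v = h (lnbr v) + h (rnbr n v) - h v" for h
      by (simp add: flip_def lap_def)
    show ?thesis
    proof (cases "locally_merged n v z")
      case merged: True
      then have "flip n v ?g v - flip n v ?h v = gap z v"
        by (auto simp: flip locally_merged_def)
      then have "gap w i = gap z v"
        using merged by (simp add: True wu coupled_move_def)
      then show ?thesis
        using gaps[OF v] by simp
    next
      case alone: False
      have "?g v - flip n v ?h v \<in> {0, 2, 4, 6}" "flip n v ?g v - ?h v \<in> {0, 2, 4, 6}"
        unfolding flip
        using gap_after_lone_flip[OF heights_nbr[OF hg(1) n v] heights_nbr[OF hg(2) n v]
            gaps[OF v] gaps[OF nb(1)] gaps[OF nb(2)] alone[unfolded locally_merged_def]]
        by blast+
      then show ?thesis
        using alone gaps[OF v] True by (simp add: wu coupled_move_def)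
    qed
  qed
  moreover have "w \<in> heights n \<times> heights n"
    using coupling_closed_heights[OF n zh] w by blast
  ultimately show "w \<in> sandwiched n"
    by (simp add: sandwiched_def)
qed

subsection \<open>A martingale\<close>

text \<open>The degrees of the path, which are the stationary weights of the reflecting random walk that
  \<^term>\<open>lap\<close> generates.\<close>

definition weight :: "nat \<Rightarrow> nat \<Rightarrow> int" where
  "weight n v = (if v = 1 \<or> v = n then 1 else 2)"

definition moment :: "nat \<Rightarrow> (nat \<Rightarrow> int) \<Rightarrow> int" where
  "moment n h = (\<Sum>v\<in>{1..n}. weight n v * h v)"

lemma moment_flip:
  assumes "v \<in> {1..n}"
  shows "moment n (flip n v h) = moment n h + weight n v * lap n v h"
  unfolding moment_def flip_def using assms by (subst weighted_sum_fun_upd) auto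

text \<open>Summation by parts. Hence the moment of a single copy is a martingale.\<close>

lemma sum_weight_lap:
  assumes n: "n \<ge> 2"
  shows "(\<Sum>v\<in>{1..n}. weight n v * lap n v h) = 0"
proof -
  define J where "J i = (if i \<in> {1..<n} then slope h i else 0)" for i
  have "weight n v * lap n v h = 2 * (J v - J (v - 1))" if v: "v \<in> {1..n}" for v
  proof -
    consider "v = 1" | "v = n" "v \<noteq> 1" | "v \<noteq> 1" "v \<noteq> n"
      by auto
    then show ?thesis
    proof cases
      case 1
      then show ?thesis using n
        by (simp add: weight_def lap_def lnbr_def rnbr_def J_def slope_def numeral_2_eq_2)
    next
      case 2
      have "n - 1 \<in> {1..<n}" "Suc (n - 1) = n"
        using n by auto
      then show ?thesis using n 2
        by (simp add: weight_def lap_def lnbr_def rnbr_def J_def slope_def)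
    next
      case 3
      then obtain i where "v = Suc i" "1 \<le> i" "Suc i < n"
        using v by (cases v) auto
      then show ?thesis
        by (simp add: weight_def lap_def lnbr_def rnbr_def J_def slope_def)
    qed
  qed
  then have "(\<Sum>v\<in>{1..n}. weight n v * lap n v h) = 2 * (\<Sum>v\<in>{Suc 0..n}. J v - J (v - 1))"
    by (simp add: sum_distrib_left)
  also have "\<dots> = 0"
    by (subst sum_telescope'') (auto simp: J_def)
  finally show ?thesis .
qed

lemma sum_weight:
  assumes "n \<ge> 2"
  shows "(\<Sum>v\<in>{1..n}. weight n v) = 2 * (int n - 1)"
proof -
  have "weight n v = 2 - (if v = 1 then 1 else 0) - (if v = n then 1 else 0)" for v
    using assms by (auto simp: weight_def)
  then show ?thesis
    using assms by (simp add: sum_subtractf)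
qed

text \<open>For a sandwiched pair this lies between 0 and \<open>12 * (n - 1)\<close>, and these two values are
  taken exactly when the colorings agree.\<close>

definition gap_moment :: "nat \<Rightarrow> height_pair \<Rightarrow> int" where
  "gap_moment n z = moment n (snd z) - moment n (fst z)"

text \<open>For a martingale \<open>x\<close> with values between 0 and \<open>b\<close>, the expectation of
  \<open>x * (b - x)\<close> decreases by the quadratic variation.\<close>

definition sandwich_potential :: "nat \<Rightarrow> height_pair \<Rightarrow> real" where
  "sandwich_potential n z =
     real_of_int (gap_moment n z * (12 * (int n - 1) - gap_moment n z))"

lemma gap_moment_eq:
  assumes "n \<ge> 2"
  shows "gap_moment n z = (\<Sum>v\<in>{1..n}. weight n v * gap z v)"
    and "12 * (int n - 1) - gap_moment n z = (\<Sum>v\<in>{1..n}. weight n v * (6 - gap z v))"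
proof -
  show *: "gap_moment n z = (\<Sum>v\<in>{1..n}. weight n v * gap z v)"
    by (simp add: gap_moment_def moment_def right_diff_distrib sum_subtractf)
  have "(\<Sum>v\<in>{1..n}. weight n v * (6 - gap z v)) =
      (\<Sum>v\<in>{1..n}. weight n v) * 6 - (\<Sum>v\<in>{1..n}. weight n v * gap z v)"
    by (simp only: right_diff_distrib[of "weight n _" 6] sum_subtractf sum_distrib_right)
  then show "12 * (int n - 1) - gap_moment n z = (\<Sum>v\<in>{1..n}. weight n v * (6 - gap z v))"
    unfolding * sum_weight[OF assms] by simp
qed

lemma weight_pos: "weight n v > 0"
  by (simp add: weight_def)

lemma gap_moment_bounds:
  assumes n: "n \<ge> 2" and z: "z \<in> sandwiched n"
  shows "0 \<le> gap_moment n z" "gap_moment n z \<le> 12 * (int n - 1)"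
    and "apart n z \<Longrightarrow> 0 < gap_moment n z" "apart n z \<Longrightarrow> gap_moment n z < 12 * (int n - 1)"
proof -
  have g: "0 \<le> weight n v * gap z v" "0 \<le> weight n v * (6 - gap z v)" if "v \<in> {1..n}" for v
  proof -
    have "gap z v \<in> {0, 2, 4, 6}"
      using z that by (simp add: sandwiched_def)
    then have "0 \<le> gap z v" "gap z v \<le> 6"
      by auto
    then show "0 \<le> weight n v * gap z v" "0 \<le> weight n v * (6 - gap z v)"
      using weight_pos[of n v] by auto
  qed
  note eq = gap_moment_eq[OF n, of z]
  show 1: "0 \<le> gap_moment n z"
    unfolding eq(1) using g(1) by (rule sum_nonneg)
  have "0 \<le> 12 * (int n - 1) - gap_moment n z"
    unfolding eq(2) using g(2) by (rule sum_nonneg)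
  then show 2: "gap_moment n z \<le> 12 * (int n - 1)"
    by simp
  show "0 < gap_moment n z" if apart: "apart n z"
  proof -
    have "gap_moment n z \<noteq> 0"
      unfolding eq(1) using apart weight_pos[of n] g(1)
      by (subst sum_nonneg_eq_0_iff) (auto simp: apart_def less_le)
    then show ?thesis
      using 1 by simp
  qed
  show "gap_moment n z < 12 * (int n - 1)" if apart: "apart n z"
  proof -
    have "12 * (int n - 1) - gap_moment n z \<noteq> 0"
      unfolding eq(2) using apart weight_pos[of n] g(2)
      by (subst sum_nonneg_eq_0_iff) (auto simp: apart_def less_le)
    then show ?thesis
      using 2 by simp
  qed
qed

lemma sandwich_potential_bounds:
  assumes n: "n \<ge> 2" and z: "z \<in> sandwiched n"
  shows "0 \<le> sandwich_potential n z" "sandwich_potential n z \<le> 36 * real n ^ 2"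
    and "apart n z \<Longrightarrow> 1 \<le> sandwich_potential n z"
proof -
  define x where "x = real_of_int (gap_moment n z)"
  define b where "b = 12 * (real n - 1)"
  have pot: "sandwich_potential n z = x * (b - x)"
    using n by (simp add: sandwich_potential_def x_def b_def of_nat_diff)
  have x: "0 \<le> x" "x \<le> b"
    using gap_moment_bounds(1,2)[OF n z] by (simp_all add: x_def b_def)
  then show "0 \<le> sandwich_potential n z"
    by (simp add: pot)
  have "x * (b - x) \<le> (b / 2) ^ 2"
    using zero_le_square[of "x - b / 2"] by (simp add: power2_eq_square algebra_simps)
  also have "\<dots> \<le> (6 * real n) ^ 2"
    using n by (intro power_mono) (auto simp: b_def)
  finally show "sandwich_potential n z \<le> 36 * real n ^ 2"
    by (simp add: pot power_mult_distrib)
  assume "apart n z"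
  then have "1 \<le> gap_moment n z * (12 * (int n - 1) - gap_moment n z)"
    using gap_moment_bounds(3,4)[OF n z]
      mult_mono[of 1 "gap_moment n z" 1 "12 * (int n - 1) - gap_moment n z"] by simp
  then show "1 \<le> sandwich_potential n z"
    unfolding sandwich_potential_def by linarith
qed

text \<open>The linear part of the drift sums to 0 over the vertices, which leaves the quadratic
  variation.\<close>

lemma vertex_drift_sandwich_potential:
  assumes v: "v \<in> {1..n}"
  shows "vertex_drift n (locally_merged n) (sandwich_potential n) v z =
    real_of_int ((12 * (int n - 1) - 2 * gap_moment n z) *
        (weight n v * lap n v (snd z) - weight n v * lap n v (fst z))
      - (if locally_merged n v z then 0
         else (weight n v * lap n v (fst z))\<^sup>2 + (weight n v * lap n v (snd z))\<^sup>2))"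
proof -
  let ?a = "weight n v * lap n v (fst z)" and ?b = "weight n v * lap n v (snd z)"
  let ?M = "gap_moment n z"
  have moves: "gap_moment n (flip n v (fst z), snd z) = ?M - ?a"
    "gap_moment n (fst z, flip n v (snd z)) = ?M + ?b"
    "gap_moment n (flip n v (fst z), flip n v (snd z)) = ?M - ?a + ?b"
    by (simp_all add: gap_moment_def moment_flip[OF v])
  show ?thesis
  proof (cases "locally_merged n v z")
    case True
    then have "lap n v (snd z) = lap n v (fst z)"
      by (auto simp: locally_merged_def lap_def)
    then show ?thesis
      using True by (simp add: vertex_drift_def sandwich_potential_def moves)
  next
    case False
    define B where "B = 12 * (int n - 1)"
    have "vertex_drift n (locally_merged n) (sandwich_potential n) v z = real_of_int
        ((?M - ?a) * (B - (?M - ?a)) + (?M + ?b) * (B - (?M + ?b)) - 2 * (?M * (B - ?M)))"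
      using False by (simp add: vertex_drift_def sandwich_potential_def moves B_def)
    also have "(?M - ?a) * (B - (?M - ?a)) + (?M + ?b) * (B - (?M + ?b)) - 2 * (?M * (B - ?M)) =
        (B - 2 * ?M) * (?b - ?a) - (?a\<^sup>2 + ?b\<^sup>2)"
      by algebra
    finally show ?thesis
      using False by (simp only: B_def if_False)
  qed
qed

text \<open>As long as the colorings differ, some vertex contributes to the quadratic variation. If the gap
  is constant, this is an end of the path, because an end can always be flipped. Otherwise the gap is
  not harmonic, and where its Laplacian does not vanish the two copies are not both stuck.\<close>

lemma ex_active_vertex:
  assumes n: "n \<ge> 2" and z: "z \<in> sandwiched n" and apart: "apart n z"
  obtains v where "v \<in> {1..n}" "\<not> locally_merged n v z"
    "lap n v (fst z) \<noteq> 0 \<or> lap n v (snd z) \<noteq> 0"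
proof (cases "\<exists>v\<in>{1..n}. lap n v (snd z) \<noteq> lap n v (fst z)")
  case True
  then obtain v where v: "v \<in> {1..n}" "lap n v (snd z) \<noteq> lap n v (fst z)"
    by blast
  from v(2) have "\<not> locally_merged n v z"
    by (auto simp: locally_merged_def lap_def)
  moreover have "lap n v (fst z) \<noteq> 0 \<or> lap n v (snd z) \<noteq> 0"
    using v(2) by auto
  ultimately show thesis
    using v(1) that by blast
next
  case False
  have Suc: "gap z (Suc i) = gap z i" if "1 \<le> i" "i < n" for i
    using that
  proof (induction i rule: dec_induct)
    case base
    have "lap n 1 (snd z) = lap n 1 (fst z)"
      using False n by auto
    then show ?case
      using n by (simp add: lap_def lnbr_def rnbr_def numeral_2_eq_2)
  next
    case (step i)
    then have "lap n (Suc i) (snd z) = lap n (Suc i) (fst z)"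
      using False by auto
    then show ?case
      using step by (simp add: lap_def lnbr_def rnbr_def)
  qed
  have const: "gap z i = gap z 1" if "1 \<le> i" "i \<le> n" for i
    using that
  proof (induction i rule: dec_induct)
    case (step i)
    then show ?case
      using Suc[of i] by simp
  qed simp
  then have "gap z 1 \<noteq> 0" "gap z 1 \<noteq> 6"
    using apart unfolding apart_def by (metis atLeastAtMost_iff)+
  then have "\<not> locally_merged n 1 z"
    by (auto simp: locally_merged_def)
  moreover have "1 \<in> {1..n}"
    using n by simp
  moreover from this have "lap n 1 (fst z) \<noteq> 0"
  proof -
    have "lnbr 1 = 2" "rnbr n 1 = 2" using n by (auto simp: lnbr_def rnbr_def)
    moreover have "fst z \<in> heights n" using z by (auto simp: sandwiched_def)
    ultimately show ?thesis
      using heights_nbr(1)[of "fst z" n 1] n by (auto simp: lap_def)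
  qed
  ultimately show thesis
    using that by blast
qed

lemma sandwich_potential_contracts:
  assumes n: "n \<ge> 2" and z: "z \<in> sandwiched n"
  shows "measure_pmf.expectation (coupling n (locally_merged n) z) (sandwich_potential n)
    \<le> (1 - 1 / (108 * real n ^ 3)) * sandwich_potential n z"
proof -
  let ?a = "\<lambda>v. weight n v * lap n v (fst z)" and ?b = "\<lambda>v. weight n v * lap n v (snd z)"
  define q where "q v = (if locally_merged n v z then 0 else (?a v)\<^sup>2 + (?b v)\<^sup>2)" for v
  have q_nonneg: "q v \<ge> 0" for v
    by (simp add: q_def)
  have "(\<Sum>v\<in>{1..n}. vertex_drift n (locally_merged n) (sandwich_potential n) v z) =
      real_of_int (\<Sum>v\<in>{1..n}. (12 * (int n - 1) - 2 * gap_moment n z) * (?b v - ?a v) - q v)"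
    by (simp only: of_int_sum vertex_drift_sandwich_potential q_def cong: sum.cong)
  also have "(\<Sum>v\<in>{1..n}. (12 * (int n - 1) - 2 * gap_moment n z) * (?b v - ?a v) - q v) =
      - (\<Sum>v\<in>{1..n}. q v)"
    by (simp only: sum_subtractf sum_distrib_left[symmetric] sum_weight_lap[OF n]) simp
  finally have drift: "(\<Sum>v\<in>{1..n}. vertex_drift n (locally_merged n) (sandwich_potential n) v z) =
      - real_of_int (\<Sum>v\<in>{1..n}. q v)"
    by simp
  have pot: "sandwich_potential n z / (36 * real n ^ 2) \<le> real_of_int (\<Sum>v\<in>{1..n}. q v)"
  proof (cases "apart n z")
    case True
    then obtain v where v: "v \<in> {1..n}" "\<not> locally_merged n v z"
        "lap n v (fst z) \<noteq> 0 \<or> lap n v (snd z) \<noteq> 0"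
      using ex_active_vertex[OF n z] by blast
    have "0 < q v"
      using v weight_pos[of n v] by (auto simp: q_def sum_power2_gt_zero_iff)
    then have "1 \<le> q v"
      by simp
    also have "\<dots> \<le> (\<Sum>v\<in>{1..n}. q v)"
      using v(1) q_nonneg by (intro member_le_sum) auto
    finally have "1 \<le> real_of_int (\<Sum>v\<in>{1..n}. q v)"
      by linarith
    moreover have "sandwich_potential n z / (36 * real n ^ 2) \<le> 1"
      using sandwich_potential_bounds(2)[OF n z] n by (simp add: field_simps)
    ultimately show ?thesis
      by linarith
  next
    case False
    then have "gap_moment n z = 0 \<or> 12 * (int n - 1) - gap_moment n z = 0"
      unfolding gap_moment_eq(2)[OF n] unfolding gap_moment_eq(1)[OF n] apart_def by auto
    then have "sandwich_potential n z = 0"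
      by (auto simp: sandwich_potential_def)
    moreover have "0 \<le> (\<Sum>v\<in>{1..n}. q v)"
      by (intro sum_nonneg q_nonneg)
    ultimately show ?thesis
      by (simp del: of_int_sum)
  qed
  have "measure_pmf.expectation (coupling n (locally_merged n) z) (sandwich_potential n)
      = sandwich_potential n z - real_of_int (\<Sum>v\<in>{1..n}. q v) / (3 * real n)"
    using n by (simp only: expectation_coupling drift)
  also have "\<dots> \<le> sandwich_potential n z - sandwich_potential n z / (36 * real n ^ 2) / (3 * real n)"
    using pot by (intro diff_left_mono divide_right_mono) auto
  also have "\<dots> = (1 - 1 / (108 * real n ^ 3)) * sandwich_potential n z"
    by (simp add: power3_eq_cube power2_eq_square algebra_simps)
  finally show ?thesis .
qed

section \<open>Mixing time\<close>

definition phase_length :: "nat \<Rightarrow> nat" where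
  "phase_length n = nat \<lceil>1296 * real n ^ 3 * ln (real n)\<rceil>"

text \<open>The constant is 12 * 108: a contraction by \<open>1 / (108 * n ^ 3)\<close> per step gains a factor
  \<open>n ^ 12\<close>, which more than makes up for the initial value of the potentials.\<close>

lemma decay_over_phase:
  assumes n: "n \<ge> 2"
  shows "(1 - 1 / (108 * real n ^ 3)) ^ phase_length n * (36 * real n ^ 3) \<le> 1 / 8"
proof -
  define d where "d = 1 / (108 * real n ^ 3)"
  define T where "T = phase_length n"
  have n3: "real n ^ 3 \<ge> 1"
    using n by (intro one_le_power) auto
  have "d \<le> 1"
    unfolding d_def using n3 by (subst divide_le_eq_1_pos; linarith)
  then have "(1 - d) ^ T \<le> exp (- d) ^ T"
    using exp_ge_add_one_self[of "- d"] by (intro power_mono) auto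
  also have "\<dots> = exp (- (d * real T))"
    by (simp add: exp_of_nat_mult[symmetric] mult.commute)
  also have "\<dots> \<le> exp (- (real 12 * ln (real n)))"
  proof -
    have "1296 * real n ^ 3 * ln (real n) \<le> real T"
      unfolding T_def phase_length_def by (rule real_nat_ceiling_ge)
    then have "d * (1296 * real n ^ 3 * ln (real n)) \<le> d * real T"
      by (intro mult_left_mono) (auto simp: d_def)
    moreover have "d * (1296 * real n ^ 3 * ln (real n)) = real 12 * ln (real n)"
      using n by (simp add: d_def)
    ultimately show ?thesis
      by simp
  qed
  also have "\<dots> = 1 / real n ^ 12"
    using n by (simp only: exp_minus exp_of_nat_mult divide_inverse mult_1) simp
  finally have "(1 - d) ^ T * (36 * real n ^ 3) \<le> 1 / real n ^ 12 * (36 * real n ^ 3)"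
    by (intro mult_right_mono) auto
  also have "\<dots> = 36 / real n ^ 9"
    using n by (simp add: field_simps flip: power_add)
  also have "\<dots> \<le> 36 / 2 ^ 9"
    using n by (intro divide_left_mono power_mono mult_pos_pos) auto
  also have "\<dots> \<le> 1 / 8"
    by simp
  finally show ?thesis
    unfolding d_def T_def .
qed

lemma prob_le_after_phase:
  assumes n: "n \<ge> 2"
    and closed: "\<And>z. z \<in> S \<Longrightarrow> set_pmf (coupling n C z) \<subseteq> S"
    and nonneg: "\<And>z. z \<in> S \<Longrightarrow> \<Phi> z \<ge> 0"
    and le: "\<And>z. z \<in> S \<Longrightarrow> \<Phi> z \<le> 36 * real n ^ 3"
    and bad: "\<And>z. z \<in> S \<Longrightarrow> z \<in> B \<Longrightarrow> \<Phi> z \<ge> 1"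
    and contract: "\<And>z. z \<in> S \<Longrightarrow> measure_pmf.expectation (coupling n C z) \<Phi>
      \<le> (1 - 1 / (108 * real n ^ 3)) * \<Phi> z"
    and z: "z \<in> S"
  shows "measure_pmf.prob (chain_dist (coupling n C) (phase_length n) z) B \<le> 1 / 8"
proof -
  let ?r = "1 - 1 / (108 * real n ^ 3)"
  have "real n ^ 3 \<ge> 1"
    using n by (intro one_le_power) auto
  then have "1 / (108 * real n ^ 3) \<le> 1"
    by (subst divide_le_eq_1_pos; linarith)
  then have r: "?r \<ge> 0"
    by simp
  have "measure_pmf.prob (chain_dist (coupling n C) (phase_length n) z) B
      \<le> ?r ^ phase_length n * \<Phi> z"
    using n r z by (intro prob_le_contracting_potential[where S = S] closed nonneg bad contract
        finite_set_pmf_coupling) auto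
  also have "\<dots> \<le> ?r ^ phase_length n * (36 * real n ^ 3)"
    using r le[OF z] by (intro mult_left_mono) auto
  also have "\<dots> \<le> 1 / 8"
    by (rule decay_over_phase[OF n])
  finally show ?thesis .
qed

definition slopes_differ :: "nat \<Rightarrow> height_pair set" where
  "slopes_differ n = {z. \<exists>i\<in>{1..<n}. slope (fst z) i \<noteq> slope (snd z) i}"

lemma first_phase:
  assumes n: "n \<ge> 2" and z: "z \<in> heights n \<times> heights n"
  shows "measure_pmf.prob (chain_dist (coupling n (stirring n)) (phase_length n) z)
    (slopes_differ n) \<le> 1 / 8"
proof (rule prob_le_after_phase[OF n coupling_closed_heights[OF n] _ _ _ _ z])
  fix w assume w: "w \<in> heights n \<times> heights n"
  show "0 \<le> mismatch_potential n w"
    by (rule mismatch_potential_nonneg)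
  show "mismatch_potential n w \<le> 36 * real n ^ 3"
    using mismatch_potential_le_cube[of n w] by (rule order.trans) simp
  show "1 \<le> mismatch_potential n w" if "w \<in> slopes_differ n"
    using that by (auto simp: slopes_differ_def intro: mismatch_potential_ge_1)
  \<comment> \<open>The slower rate of the other potential serves for both.\<close>
  have "(1 - 2 / (3 * real n ^ 3)) * mismatch_potential n w
      \<le> (1 - 1 / (108 * real n ^ 3)) * mismatch_potential n w"
    using n by (intro mult_right_mono mismatch_potential_nonneg) (simp add: field_simps)
  then show "measure_pmf.expectation (coupling n (stirring n) w) (mismatch_potential n)
      \<le> (1 - 1 / (108 * real n ^ 3)) * mismatch_potential n w"
    using mismatch_potential_contracts[OF n w] by linarith
qed

lemma second_phase:
  assumes n: "n \<ge> 2" and z: "z \<in> sandwiched n"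
  shows "measure_pmf.prob (chain_dist (coupling n (locally_merged n)) (phase_length n) z)
    {w. coloring n (fst w) \<noteq> coloring n (snd w)} \<le> 1 / 8"
proof (rule prob_le_after_phase[OF n sandwiched_closed[OF n] _ _ _ _ z])
  fix w assume w: "w \<in> sandwiched n"
  show "0 \<le> sandwich_potential n w"
    by (rule sandwich_potential_bounds(1)[OF n w])
  have "36 * real n ^ 2 \<le> 36 * real n ^ 3"
    using n by (intro mult_left_mono power_increasing) auto
  then show "sandwich_potential n w \<le> 36 * real n ^ 3"
    using sandwich_potential_bounds(2)[OF n w] by linarith
  show "1 \<le> sandwich_potential n w" if "w \<in> {w. coloring n (fst w) \<noteq> coloring n (snd w)}"
    using that sandwich_potential_bounds(3)[OF n w] apart_if_colorings_differ by blast
  show "measure_pmf.expectation (coupling n (locally_merged n) w) (sandwich_potential n)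
      \<le> (1 - 1 / (108 * real n ^ 3)) * sandwich_potential n w"
    by (rule sandwich_potential_contracts[OF n w])
qed

text \<open>If the slopes agree, then the heights differ by a constant. Modulo 3 this constant is one of
  0, 2, 4, so that the second height function can be shifted into the sandwich.\<close>

lemma ex_sandwiched_lift:
  assumes z: "z \<in> heights n \<times> heights n"
  shows "\<exists>w \<in> heights n \<times> heights n. coloring n (fst w) = coloring n (fst z) \<and>
    coloring n (snd w) = coloring n (snd z) \<and> (z \<notin> slopes_differ n \<longrightarrow> w \<in> sandwiched n)"
proof (cases "z \<in> slopes_differ n")
  case False
  define c where "c = gap z 1"
  have gap: "snd z i = fst z i + c" if "1 \<le> i" "i \<le> n" for i
    using that
  proof (induction i rule: dec_induct)
    case (step i)
    then have "slope (fst z) i = slope (snd z) i"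
      using False by (auto simp: slopes_differ_def)
    then show ?case
      using step by (simp add: slope_def)
  qed (simp add: c_def)
  define d where "d = 2 * ((2 * c) mod 3)"
  have "(2 * c) mod 3 = 0 \<or> (2 * c) mod 3 = 1 \<or> (2 * c) mod 3 = 2"
    using pos_mod_bound[of 3 "2 * c"] pos_mod_sign[of 3 "2 * c"] by linarith
  then have d: "d \<in> {0, 2, 4, 6}"
    by (auto simp: d_def)
  have "d mod 3 = (c + c * 3) mod 3"
    unfolding d_def by (simp add: mod_mult_right_eq)
  then have dc: "d mod 3 = c mod 3"
    by (simp only: mod_mult_self1)
  let ?w = "(fst z, \<lambda>i. fst z i + d)"
  have "?w \<in> heights n \<times> heights n"
    using z by (auto simp: heights_def)
  moreover have "coloring n (snd ?w) = coloring n (snd z)"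
    using gap mod_add_cong[OF refl dc] by (auto simp: coloring_def fun_eq_iff)
  moreover have "?w \<in> sandwiched n"
    using d \<open>?w \<in> heights n \<times> heights n\<close> by (simp add: sandwiched_def)
  ultimately show ?thesis
    by (intro bexI[of _ ?w]) auto
qed (use z in auto)

text \<open>Both phases in a row, as a joint law of the two chains.\<close>

lemma ex_coupling_of_chains:
  assumes n: "n \<ge> 2" and x: "x \<in> proper_colorings 3 n" and y: "y \<in> proper_colorings 3 n"
  shows "\<exists>\<rho>. map_pmf (\<lambda>w. coloring n (fst w)) \<rho> = chain_dist (glauber 3 n) (2 * phase_length n) x \<and>
    map_pmf (\<lambda>w. coloring n (snd w)) \<rho> = chain_dist (glauber 3 n) (2 * phase_length n) y \<and>
    measure_pmf.prob \<rho> {w. coloring n (fst w) \<noteq> coloring n (snd w)} \<le> 1 / 4"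
proof -
  let ?T = "phase_length n" and ?S = "heights n \<times> heights n"
  let ?K = "glauber 3 n"
  obtain h where h: "h \<in> heights n" "coloring n h = x"
    by (rule ex_height_lift[OF x])
  obtain g where g: "g \<in> heights n" "coloring n g = y"
    by (rule ex_height_lift[OF y])
  note hg = h g
  define \<rho>1 where "\<rho>1 = chain_dist (coupling n (stirring n)) ?T (h, g)"
  have "\<forall>z\<in>?S. \<exists>w. w \<in> ?S \<and> coloring n (fst w) = coloring n (fst z) \<and>
      coloring n (snd w) = coloring n (snd z) \<and> (z \<notin> slopes_differ n \<longrightarrow> w \<in> sandwiched n)"
    using ex_sandwiched_lift[of _ n] by (intro ballI) (simp only: Bex_def)
  from bchoice[OF this] obtain L where L': "\<forall>z\<in>?S. L z \<in> ?S \<and>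
      coloring n (fst (L z)) = coloring n (fst z) \<and> coloring n (snd (L z)) = coloring n (snd z) \<and>
      (z \<notin> slopes_differ n \<longrightarrow> L z \<in> sandwiched n)"
    by (elim exE)
  have L: "\<And>z. z \<in> ?S \<Longrightarrow> L z \<in> ?S"
      "\<And>z. z \<in> ?S \<Longrightarrow> coloring n (fst (L z)) = coloring n (fst z)"
      "\<And>z. z \<in> ?S \<Longrightarrow> coloring n (snd (L z)) = coloring n (snd z)"
      "\<And>z. z \<in> ?S \<Longrightarrow> z \<notin> slopes_differ n \<Longrightarrow> L z \<in> sandwiched n"
    using bspec[OF L'] by blast+
  define \<rho> where "\<rho> = bind_pmf \<rho>1 (\<lambda>z. chain_dist (coupling n (locally_merged n)) ?T (L z))"
  have hgS: "(h, g) \<in> ?S"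
    using hg by simp
  have sub: "set_pmf \<rho>1 \<subseteq> ?S"
    unfolding \<rho>1_def by (rule set_pmf_chain_dist[OF coupling_closed_heights[OF n] hgS])
  have "map_pmf (\<lambda>w. coloring n (fst w)) \<rho> = bind_pmf \<rho>1 (\<lambda>z. chain_dist ?K ?T (coloring n (fst z)))"
    unfolding \<rho>_def map_bind_pmf
  proof (intro bind_pmf_cong refl)
    fix z assume "z \<in> set_pmf \<rho>1"
    then have "z \<in> ?S"
      using sub by blast
    then show "map_pmf (\<lambda>w. coloring n (fst w)) (chain_dist (coupling n (locally_merged n)) ?T (L z)) =
        chain_dist ?K ?T (coloring n (fst z))"
      using L(1,2)[of z] by (simp only: chain_coupling_marginals(1)[OF n])
  qed
  also have "\<dots> = bind_pmf (map_pmf (\<lambda>w. coloring n (fst w)) \<rho>1) (chain_dist ?K ?T)"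
    by (simp add: bind_map_pmf)
  also have "\<dots> = chain_dist ?K (2 * ?T) x"
    unfolding \<rho>1_def chain_coupling_marginals(1)[OF n hgS]
    using hg by (simp add: mult_2 chain_dist_add)
  finally have fst: "map_pmf (\<lambda>w. coloring n (fst w)) \<rho> = chain_dist ?K (2 * ?T) x" .
  have "map_pmf (\<lambda>w. coloring n (snd w)) \<rho> = bind_pmf \<rho>1 (\<lambda>z. chain_dist ?K ?T (coloring n (snd z)))"
    unfolding \<rho>_def map_bind_pmf
  proof (intro bind_pmf_cong refl)
    fix z assume "z \<in> set_pmf \<rho>1"
    then have "z \<in> ?S"
      using sub by blast
    then show "map_pmf (\<lambda>w. coloring n (snd w)) (chain_dist (coupling n (locally_merged n)) ?T (L z)) =
        chain_dist ?K ?T (coloring n (snd z))"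
      using L(1,3)[of z] by (simp only: chain_coupling_marginals(2)[OF n])
  qed
  also have "\<dots> = bind_pmf (map_pmf (\<lambda>w. coloring n (snd w)) \<rho>1) (chain_dist ?K ?T)"
    by (simp add: bind_map_pmf)
  also have "\<dots> = chain_dist ?K (2 * ?T) y"
    unfolding \<rho>1_def chain_coupling_marginals(2)[OF n hgS]
    using hg by (simp add: mult_2 chain_dist_add)
  finally have snd: "map_pmf (\<lambda>w. coloring n (snd w)) \<rho> = chain_dist ?K (2 * ?T) y" .
  have "measure_pmf.prob \<rho> {w. coloring n (fst w) \<noteq> coloring n (snd w)}
      \<le> measure_pmf.prob \<rho>1 (slopes_differ n) + 1 / 8"
    unfolding \<rho>_def
  proof (rule prob_bind_pmf_le)
    fix z assume "z \<in> set_pmf \<rho>1" "z \<notin> slopes_differ n"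
    then have "L z \<in> sandwiched n"
      using L(4) sub by blast
    then show "measure_pmf.prob (chain_dist (coupling n (locally_merged n)) ?T (L z))
        {w. coloring n (fst w) \<noteq> coloring n (snd w)} \<le> 1 / 8"
      by (rule second_phase[OF n])
  qed simp
  also have "\<dots> \<le> 1 / 8 + 1 / 8"
    unfolding \<rho>1_def using first_phase[OF n hgS] by simp
  finally have "measure_pmf.prob \<rho> {w. coloring n (fst w) \<noteq> coloring n (snd w)} \<le> 1 / 4"
    by simp
  with fst snd show ?thesis
    by blast
qed

text \<open>The second copy is started from the stationary distribution, and stays there.\<close>

lemma tv_dist_glauber_le:
  assumes n: "n \<ge> 2" and x: "x \<in> proper_colorings 3 n"
  shows "tv_dist (proper_colorings 3 n) (chain_dist (glauber 3 n) (2 * phase_length n) x)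
    (pmf_of_set (proper_colorings 3 n)) \<le> 1 / 4"
proof -
  let ?S = "proper_colorings 3 n" and ?P = "chain_dist (glauber 3 n) (2 * phase_length n)"
  let ?\<pi> = "pmf_of_set ?S"
  have fin: "finite ?S"
    by (rule finite_proper_colorings)
  have set: "set_pmf ?\<pi> = ?S"
    using proper_colorings_nonempty[of 3 n] fin by (intro set_pmf_of_set) simp_all
  have "\<forall>y\<in>?S. \<exists>\<rho>. map_pmf (\<lambda>w. coloring n (fst w)) \<rho> = ?P x \<and>
      map_pmf (\<lambda>w. coloring n (snd w)) \<rho> = ?P y \<and>
      measure_pmf.prob \<rho> {w. coloring n (fst w) \<noteq> coloring n (snd w)} \<le> 1 / 4"
    by (intro ballI ex_coupling_of_chains[OF n x])
  from bchoice[OF this] obtain \<rho> where \<rho>': "\<forall>y\<in>?S. map_pmf (\<lambda>w. coloring n (fst w)) (\<rho> y) = ?P x \<and>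
      map_pmf (\<lambda>w. coloring n (snd w)) (\<rho> y) = ?P y \<and>
      measure_pmf.prob (\<rho> y) {w. coloring n (fst w) \<noteq> coloring n (snd w)} \<le> 1 / 4"
    by (elim exE)
  have \<rho>: "map_pmf (\<lambda>w. coloring n (fst w)) (\<rho> y) = ?P x"
      "map_pmf (\<lambda>w. coloring n (snd w)) (\<rho> y) = ?P y"
      "measure_pmf.prob (\<rho> y) {w. coloring n (fst w) \<noteq> coloring n (snd w)} \<le> 1 / 4"
    if "y \<in> ?S" for y
    using bspec[OF \<rho>' that] by blast+
  define R where "R = bind_pmf ?\<pi> \<rho>"
  have "map_pmf (\<lambda>w. coloring n (fst w)) R = bind_pmf ?\<pi> (\<lambda>_. ?P x)"
    unfolding R_def map_bind_pmf using \<rho>(1) set by (intro bind_pmf_cong refl) auto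
  then have fst: "map_pmf (\<lambda>w. coloring n (fst w)) R = ?P x"
    by simp
  have "map_pmf (\<lambda>w. coloring n (snd w)) R = bind_pmf ?\<pi> ?P"
    unfolding R_def map_bind_pmf using \<rho>(2) set by (intro bind_pmf_cong refl) auto
  then have snd: "map_pmf (\<lambda>w. coloring n (snd w)) R = ?\<pi>"
    using stationary_chain_dist[OF uniform_stationary] n by simp
  have "tv_dist ?S (?P x) ?\<pi> \<le> measure_pmf.prob R {w. coloring n (fst w) \<noteq> coloring n (snd w)}"
    unfolding fst[symmetric] by (subst snd[symmetric]) (rule tv_dist_map_pmf_le[OF fin])
  also have "\<dots> \<le> measure_pmf.prob ?\<pi> {} + 1 / 4"
    unfolding R_def using \<rho>(3) set by (intro prob_bind_pmf_le) auto
  finally show ?thesis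
    by simp
qed

lemma glauber_mix_le:
  assumes n: "n \<ge> 2"
  shows "glauber_mix 3 n (1 / 4) \<le> enat (2 * phase_length n)"
  unfolding glauber_mix_def mix_def mix_from_def
proof (intro SUP_least INF_lower CollectI conjI tv_dist_glauber_le n)
  have "0 < 1296 * real n ^ 3 * ln (real n)"
    using n by simp
  then show "0 < 2 * phase_length n"
    by (simp add: phase_length_def)
qed

theorem theorem3:
  shows "(\<forall>\<^sub>F n in sequentially. glauber_mix 3 n (1 / 4) \<noteq> \<infinity>) \<and>
    (\<lambda>n. real (the_enat (glauber_mix 3 n (1 / 4)))) \<in> O(\<lambda>n. real n ^ 3 * ln (real n))"
proof
  show "\<forall>\<^sub>F n in sequentially. glauber_mix 3 n (1 / 4) \<noteq> \<infinity>"
    using eventually_ge_at_top[of 2]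
  proof eventually_elim
    case (elim n)
    show ?case
    proof
      assume "glauber_mix 3 n (1 / 4) = \<infinity>"
      then show False
        using glauber_mix_le[OF elim] by simp
    qed
  qed
  show "(\<lambda>n. real (the_enat (glauber_mix 3 n (1 / 4)))) \<in> O(\<lambda>n. real n ^ 3 * ln (real n))"
  proof (rule bigoI[where c = 2594])
    show "\<forall>\<^sub>F n in sequentially. norm (real (the_enat (glauber_mix 3 n (1 / 4))))
        \<le> 2594 * norm (real n ^ 3 * ln (real n))"
      using eventually_ge_at_top[of 3]
    proof eventually_elim
      case (elim n)
      let ?x = "real n ^ 3 * ln (real n)"
      have "exp 1 \<le> real n"
        using exp_le elim by linarith
      then have "1 \<le> ln (real n)"
        using elim by (subst ln_ge_iff) auto
      moreover have "1 \<le> real n ^ 3"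
        using elim by (intro one_le_power) auto
      ultimately have x: "1 \<le> ?x"
        using mult_mono[of 1 "real n ^ 3" 1 "ln (real n)"] by simp
      have "the_enat (glauber_mix 3 n (1 / 4)) \<le> 2 * phase_length n"
        using glauber_mix_le[of n] elim by (cases "glauber_mix 3 n (1 / 4)") auto
      then have "real (the_enat (glauber_mix 3 n (1 / 4))) \<le> 2 * real (phase_length n)"
        by linarith
      also have "real (phase_length n) \<le> 1296 * ?x + 1"
        using x unfolding phase_length_def by (simp add: mult.assoc)
      finally show ?case
        using x by simp
    qed
  qed
qed

end
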